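(* Let $m=(m_0,m_1,\dots)$ be any sequence of integers with $m_k\ge 2$ for all $k$ and $\sup_k m_k<\infty$, and let $G_m$ be the corresponding bounded Vilenkin group. Then there exists a martingale $f=(f^{(n)},n\in\mathbb N)$ in the martingale Hardy space $H_{1/2}(G_m)$ such that its Fejér means $\sigma_n f$ with respect to the Vilenkin system satisfy $$\sup_{n\in\mathbb N_+}\left\|\sigma_n f\right\|_{1/2}=+\infty .$$
   Context: Notation: $\mathbb N_+$ is the set of positive integers and $\mathbb N=\mathbb N_+\cup\{0\}$. Vilenkin group: given a sequence $m=(m_0,m_1,\dots)$ of integers $m_k\ge 2$, let $Z_{m_k}=\{0,1,\dots,m_k-1\}$ be the additive group of integers modulo $m_k$. $G_m$ is the complete direct product of the groups $Z_{m_k}$, $k\in\mathbb N$, with the product of the discrete topologies; its elements are sequences $x=(x_0,x_1,\dots)$ with $x_k\in Z_{m_k}$. The measure $\mu$ is the product of the uniform measures $\mu_k(\{j\})=1/m_k$ on $Z_{m_k}$, i.e. the Haar measure on $G_m$ with $\mu(G_m)=1$. The group is called bounded if $\sup_k m_k<\infty$. Intervals: $I_0(x)=G_m$ and $I_n(x)=\{y\in G_m: y_0=x_0,\dots,y_{n-1}=x_{n-1}\}$ for $x\in G_m$, $n\in\mathbb N_+$. Vilenkin system: put $M_0=1$, $M_{k+1}=m_kM_k$. Every $n\in\mathbb N$ is uniquely $n=\sum_{j=0}^\infty n_jM_j$ with $n_j\in Z_{m_j}$, only finitely many $n_j$ nonzero. Let $r_k(x)=\exp(2\pi i x_k/m_k)$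 (with $i^2=-1$) and $\psi_n(x)=\prod_{k=0}^\infty r_k(x)^{n_k}$ for $n\in\mathbb N$. Martingales and Hardy spaces: let $\mathcal F_n$ be the $\sigma$-algebra generated by $\{I_n(x):x\in G_m\}$. A martingale $f=(f^{(n)},n\in\mathbb N)$ is a martingale on $(G_m,\mu)$ with respect to $(\mathcal F_n)_{n\in\mathbb N}$. Its maximal function is $f^*=\sup_{n\in\mathbb N}|f^{(n)}|$. For $0<p<\infty$, $\|g\|_p=\left(\int_{G_m}|g|^p\,d\mu\right)^{1/p}$ (possibly $+\infty$), and $H_p(G_m)$ is the set of martingales $f$ with $\|f\|_{H_p}:=\|f^*\|_p<\infty$. Fejér means of a martingale: the Vilenkin-Fourier coefficients of $f$ are $\widehat f(j)=\lim_{k\to\infty}\int_{G_m}f^{(k)}\,\overline{\psi_j}\,d\mu$, $j\in\mathbb N$; the partial sums are $S_0f=0$, $S_nf=\sum_{j=0}^{n-1}\widehat f(j)\psi_j$ for $n\in\mathbb N_+$; the Fejér means are $\sigma_nf=\frac1n\sum_{k=0}^{n-1}S_kf$ for $n\in\mathbb N_+$. *)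

theory Defs
  imports "HOL-Probability.Probability"
begin

text \<open>The group carries the product sigma-algebra and the product of the uniform measures. Its
  points are the sequences \<open>x\<close> with \<open>x k < m k\<close> for all \<open>k\<close>.\<close>

definition vilenkin :: "(nat \<Rightarrow> nat) \<Rightarrow> (nat \<Rightarrow> nat) measure" where
  "vilenkin m = (\<Pi>\<^sub>M k\<in>UNIV. uniform_count_measure {..<m k})"

definition vil_interval :: "(nat \<Rightarrow> nat) \<Rightarrow> nat \<Rightarrow> (nat \<Rightarrow> nat) \<Rightarrow> (nat \<Rightarrow> nat) set" where
  "vil_interval m n x = {y \<in> space (vilenkin m). \<forall>k<n. y k = x k}"

definition vil_filtration :: "(nat \<Rightarrow> nat) \<Rightarrow> nat \<Rightarrow> (nat \<Rightarrow> nat) measure" where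
  "vil_filtration m n =
     sigma (space (vilenkin m)) {vil_interval m n x | x. x \<in> space (vilenkin m)}"

lemma space_vilenkin: "space (vilenkin m) = {x. \<forall>k. x k < m k}"
  by (auto simp: vilenkin_def space_PiM space_uniform_count_measure PiE_def Pi_def)

lemma prob_space_vilenkin:
  assumes "\<And>k. m k \<ge> 2"
  shows "prob_space (vilenkin m)"
  unfolding vilenkin_def
proof (rule prob_space_PiM)
  fix k
  have "m k \<noteq> 0" using assms[of k] by simp
  then show "prob_space (uniform_count_measure {..<m k})"
    by (intro prob_space_uniform_count_measure) (auto simp: lessThan_empty_iff)
qed

lemma vil_interval_sets: "vil_interval m n x \<in> sets (vilenkin m)"
proof -
  have "{y \<in> space (vilenkin m). y k = x k} \<in> sets (vilenkin m)" for k
  proof -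
    have "(\<lambda>y. y k) \<in> measurable (vilenkin m) (uniform_count_measure {..<m k})"
      unfolding vilenkin_def by (rule measurable_component_singleton) simp
    moreover have "{..<m k} \<inter> {x k} \<in> sets (uniform_count_measure {..<m k})"
      by (simp add: sets_uniform_count_measure)
    ultimately have "(\<lambda>y. y k) -` ({..<m k} \<inter> {x k}) \<inter> space (vilenkin m) \<in> sets (vilenkin m)"
      by (rule measurable_sets)
    also have "(\<lambda>y. y k) -` ({..<m k} \<inter> {x k}) \<inter> space (vilenkin m)
        = {y \<in> space (vilenkin m). y k = x k}"
      by (auto simp: space_vilenkin)
    finally show ?thesis .
  qed
  then show ?thesis
    unfolding vil_interval_def by (intro sets.sets_Collect_countable_All sets.sets_Collect_imp) auto
qed

lemma subalgebra_vil_filtration: "subalgebra (vilenkin m) (vil_filtration m n)"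
proof -
  have "{vil_interval m n x | x. x \<in> space (vilenkin m)} \<subseteq> sets (vilenkin m)"
    using vil_interval_sets by auto
  then show ?thesis
    unfolding subalgebra_def vil_filtration_def
    by (simp add: space_measure_of_conv sets.sigma_sets_subset sets_measure_of_conv)
qed

definition vil_M :: "(nat \<Rightarrow> nat) \<Rightarrow> nat \<Rightarrow> nat" where
  "vil_M m k = (\<Prod>j<k. m j)"

definition vil_digit :: "(nat \<Rightarrow> nat) \<Rightarrow> nat \<Rightarrow> nat \<Rightarrow> nat" where
  "vil_digit m n j = (n div vil_M m j) mod m j"

definition rademacher :: "(nat \<Rightarrow> nat) \<Rightarrow> nat \<Rightarrow> (nat \<Rightarrow> nat) \<Rightarrow> complex" where
  "rademacher m k x = exp (2 * of_real pi * \<i> * of_nat (x k) / of_nat (m k))"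

text \<open>The product over all \<open>k\<close> is restricted to the finitely many nonzero digits of \<open>n\<close>.\<close>

definition vil_psi :: "(nat \<Rightarrow> nat) \<Rightarrow> nat \<Rightarrow> (nat \<Rightarrow> nat) \<Rightarrow> complex" where
  "vil_psi m n x = (\<Prod>k | vil_digit m n k \<noteq> 0. rademacher m k x ^ vil_digit m n k)"

text \<open>The following facts state that \<open>vil_digit\<close> is the mixed radix expansion, and the only one.\<close>

lemma vil_M_simps: "vil_M m 0 = 1" "vil_M m (Suc k) = m k * vil_M m k"
  by (simp_all add: vil_M_def)

lemma vil_M_gt:
  assumes "\<And>k. m k \<ge> 2"
  shows "n < vil_M m n"
proof (induction n)
  case (Suc n)
  have "2 * vil_M m n \<le> m n * vil_M m n" using assms by (rule mult_le_mono1)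
  then have "Suc n < m n * vil_M m n" using Suc by linarith
  then show ?case by (simp add: vil_M_simps)
qed (simp add: vil_M_simps)

lemma vil_M_mono:
  assumes "\<And>k. m k \<ge> 2" "i \<le> j"
  shows "vil_M m i \<le> vil_M m j"
proof (rule lift_Suc_mono_le[OF _ assms(2)])
  fix n
  have "1 * vil_M m n \<le> m n * vil_M m n"
    using assms(1)[of n] by (intro mult_le_mono1) linarith
  then show "vil_M m n \<le> vil_M m (Suc n)" by (simp add: vil_M_simps)
qed

lemma vil_digit_less:
  assumes "\<And>k. m k \<ge> 2"
  shows "vil_digit m n j < m j"
  using assms[of j] by (simp add: vil_digit_def)

lemma finite_vil_digits:
  assumes "\<And>k. m k \<ge> 2"
  shows "finite {j. vil_digit m n j \<noteq> 0}"
proof (rule finite_subset)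
  show "{j. vil_digit m n j \<noteq> 0} \<subseteq> {..<n}"
  proof
    fix j assume *: "j \<in> {j. vil_digit m n j \<noteq> 0}"
    show "j \<in> {..<n}"
    proof (rule ccontr)
      assume "j \<notin> {..<n}"
      then have "n < vil_M m j"
        using vil_M_gt[of m n, OF assms] vil_M_mono[of m n j, OF assms] by simp
      with * show False by (simp add: vil_digit_def)
    qed
  qed
qed simp

lemma vil_digit_partial_sum:
  "(\<Sum>j<k. vil_digit m n j * vil_M m j) = n mod vil_M m k"
proof (induction k)
  case (Suc k)
  have "n mod (vil_M m k * m k) = vil_M m k * (n div vil_M m k mod m k) + n mod vil_M m k"
    by (rule mod_mult2_eq)
  then show ?case using Suc by (simp add: vil_M_simps vil_digit_def mult.commute)
qed (simp add: vil_M_simps)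

lemma vil_digit_expansion:
  assumes "\<And>k. m k \<ge> 2"
  shows "n = (\<Sum>j | vil_digit m n j \<noteq> 0. vil_digit m n j * vil_M m j)"
proof -
  obtain K where K: "{j. vil_digit m n j \<noteq> 0} \<subseteq> {..<K}"
    using finite_vil_digits[of m n, OF assms] finite_nat_iff_bounded by blast
  let ?k = "max K n"
  have "n < vil_M m ?k"
    using vil_M_gt[of m n, OF assms] vil_M_mono[of m n ?k, OF assms] by simp
  then have "n = (\<Sum>j<?k. vil_digit m n j * vil_M m j)"
    by (simp add: vil_digit_partial_sum)
  also have "\<dots> = (\<Sum>j | vil_digit m n j \<noteq> 0. vil_digit m n j * vil_M m j)"
    using K by (intro sum.mono_neutral_right) auto
  finally show ?thesis .
qed

lemma vil_digit_unique:
  assumes m: "\<And>k. m k \<ge> 2" and d: "\<And>j. d j < m j" and fin: "finite {j. d j \<noteq> 0}"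
    and n: "n = (\<Sum>j | d j \<noteq> 0. d j * vil_M m j)"
  shows "d = vil_digit m n"
proof
  fix i
  have less: "(\<Sum>j<k. d j * vil_M m j) < vil_M m k" for k
  proof (induction k)
    case (Suc k)
    have "(d k + 1) * vil_M m k \<le> m k * vil_M m k"
      using d[of k] by (intro mult_le_mono1) simp
    then show ?case using Suc by (simp add: vil_M_simps)
  qed (simp add: vil_M_simps)
  obtain K where K: "{j. d j \<noteq> 0} \<subseteq> {..<K}"
    using fin finite_nat_iff_bounded by blast
  let ?k = "max K (Suc i)"
  have "n = (\<Sum>j<?k. d j * vil_M m j)"
    unfolding n using K by (intro sum.mono_neutral_left) auto
  also have "{..<?k} = {..<i} \<union> {i} \<union> {Suc i..<?k}" by auto
  also have "(\<Sum>j\<in>\<dots>. d j * vil_M m j)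
      = (\<Sum>j<i. d j * vil_M m j) + d i * vil_M m i + (\<Sum>j=Suc i..<?k. d j * vil_M m j)"
    by (subst sum.union_disjoint; force)+
  finally have n_eq: "n = (\<Sum>j<i. d j * vil_M m j) + d i * vil_M m i
      + (\<Sum>j=Suc i..<?k. d j * vil_M m j)" .
  have "vil_M m (Suc i) dvd vil_M m j" if "Suc i \<le> j" for j
    unfolding vil_M_def using that by (intro prod_dvd_prod_subset) auto
  then have "vil_M m (Suc i) dvd (\<Sum>j=Suc i..<?k. d j * vil_M m j)"
    by (intro dvd_sum dvd_mult) auto
  then obtain c where "(\<Sum>j=Suc i..<?k. d j * vil_M m j) = vil_M m (Suc i) * c" ..
  then have "n = (\<Sum>j<i. d j * vil_M m j) + (d i + m i * c) * vil_M m i"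
    using n_eq by (simp add: vil_M_simps algebra_simps)
  moreover have "vil_M m i \<noteq> 0" using less[of i] by simp
  ultimately have "n div vil_M m i = d i + m i * c"
    using less[of i] by simp
  then show "d i = vil_digit m n i" using d[of i] by (simp add: vil_digit_def)
qed

text \<open>Martingales are complex-valued; \<^const>\<open>real_cond_exp\<close> is applied to real and imaginary
  part.\<close>

definition vil_martingale :: "(nat \<Rightarrow> nat) \<Rightarrow> (nat \<Rightarrow> (nat \<Rightarrow> nat) \<Rightarrow> complex) \<Rightarrow> bool" where
  "vil_martingale m f \<longleftrightarrow>
     (\<forall>n. f n \<in> borel_measurable (vil_filtration m n) \<and> integrable (vilenkin m) (f n)) \<and>
     (\<forall>n k. n \<le> k \<longrightarrow>
        (AE x in vilenkin m.
           real_cond_exp (vilenkin m) (vil_filtration m n) (\<lambda>y. Re (f k y)) x = Re (f n x) \<and>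
           real_cond_exp (vilenkin m) (vil_filtration m n) (\<lambda>y. Im (f k y)) x = Im (f n x)))"

text \<open>Powers with a positive exponent on the extended half-line.\<close>

definition enn_powr :: "ennreal \<Rightarrow> real \<Rightarrow> ennreal" where
  "enn_powr t a = (if t = \<infinity> then \<infinity> else ennreal (enn2real t powr a))"

definition Lp_norm :: "'a measure \<Rightarrow> real \<Rightarrow> ('a \<Rightarrow> ennreal) \<Rightarrow> ennreal" where
  "Lp_norm M p g = enn_powr (\<integral>\<^sup>+ x. enn_powr (g x) p \<partial>M) (1 / p)"

definition max_fun :: "(nat \<Rightarrow> 'a \<Rightarrow> complex) \<Rightarrow> 'a \<Rightarrow> ennreal" where
  "max_fun f x = (SUP n. ennreal (cmod (f n x)))"

definition hardy_space :: "(nat \<Rightarrow> nat) \<Rightarrow> real \<Rightarrow> (nat \<Rightarrow> (nat \<Rightarrow> nat) \<Rightarrow> complex) set" where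
  "hardy_space m p = {f. vil_martingale m f \<and> Lp_norm (vilenkin m) p (max_fun f) < \<infinity>}"

definition vil_coeff :: "(nat \<Rightarrow> nat) \<Rightarrow> (nat \<Rightarrow> (nat \<Rightarrow> nat) \<Rightarrow> complex) \<Rightarrow> nat \<Rightarrow> complex" where
  "vil_coeff m f j = lim (\<lambda>k. \<integral>x. f k x * cnj (vil_psi m j x) \<partial>vilenkin m)"

definition vil_partial_sum ::
    "(nat \<Rightarrow> nat) \<Rightarrow> (nat \<Rightarrow> (nat \<Rightarrow> nat) \<Rightarrow> complex) \<Rightarrow> nat \<Rightarrow> (nat \<Rightarrow> nat) \<Rightarrow> complex" where
  "vil_partial_sum m f n x = (\<Sum>j<n. vil_coeff m f j * vil_psi m j x)"

definition fejer_mean ::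
    "(nat \<Rightarrow> nat) \<Rightarrow> (nat \<Rightarrow> (nat \<Rightarrow> nat) \<Rightarrow> complex) \<Rightarrow> nat \<Rightarrow> (nat \<Rightarrow> nat) \<Rightarrow> complex" where
  "fejer_mean m f n x = (\<Sum>k<n. vil_partial_sum m f k x) / of_nat n"

end

theory Submission
  imports Defs "HOL-Real_Asymp.Real_Asymp"
begin

text \<open>
  The kernels \<open>F\<^sub>q = \<Sum>\<^bsub>i<q\<^esub> D\<^sub>i\<close> (that is, \<open>q\<close> times the Fejer kernels,
  \<open>D\<^sub>i\<close> being the Dirichlet kernels) are not bounded in \<open>L\<^sub>1\<^sub>/\<^sub>2\<close>. For \<open>q \<le> M\<^sub>s\<close> one has
  \<open>F\<^bsub>M\<^sub>s + q\<^esub> = F\<^bsub>M\<^sub>s\<^esub> + q D\<^bsub>M\<^sub>s\<^esub> + r\<^sub>s F\<^sub>q\<close>. The first two terms vanish unless at most one of the first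
  \<open>s\<close> coordinates is nonzero, and the measure of the set of these points tends to \<open>0\<close>; on the part of
  it where only the coordinate \<open>s - 1\<close> is nonzero, \<open>F\<^bsub>M\<^sub>s\<^esub>\<close> alone contributes at least \<open>1/2\<close> to
  \<open>\<integral> \<bar>F\<bar>\<^sup>1\<^sup>/\<^sup>2\<close>. Hence each sufficiently sparse new digit of \<open>q\<close> increases this integral by a fixed
  amount.

  The martingale is \<open>\<Sum>\<^sub>k c\<^sub>k (D\<^bsub>M(N\<^sub>k + 1)\<^esub> - D\<^bsub>M(N\<^sub>k)\<^esub>)\<close> with \<open>c\<^sub>k = M(N\<^sub>k) / 4\<^sup>k\<close>. The \<open>k\<close>-th block
  has \<open>H\<^sub>1\<^sub>/\<^sub>2\<close> quasinorm of order \<open>4\<^sup>-\<^sup>k\<close>, while for \<open>n = M(N\<^sub>k) + q\<close> it contributes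
  \<open>c\<^sub>k r F\<^sub>q / n\<close> to the Fejer mean \<open>\<sigma>\<^sub>n f\<close>, where \<open>r\<close> is the Rademacher function with index \<open>N\<^sub>k\<close>.
  The earlier blocks contribute a bounded function whose bound depends only on them, so \<open>q\<close> and
  \<open>N\<^sub>k\<close> can be chosen afterwards to make the new contribution dominate.
\<close>

lemma sum_lessThan_add:
  fixes f :: "nat \<Rightarrow> 'a::comm_monoid_add"
  shows "(\<Sum>i<a+b. f i) = (\<Sum>i<a. f i) + (\<Sum>i<b. f (a + i))"
  by (induction b) (simp_all add: add.assoc)

lemma enn_powr_ennreal: "0 \<le> t \<Longrightarrow> enn_powr (ennreal t) a = ennreal (t powr a)"
  by (simp add: enn_powr_def)

subsection \<open>Vilenkin functions\<close>

locale vilenkin_group =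
  fixes m :: "nat \<Rightarrow> nat"
  assumes ge2: "\<And>k. m k \<ge> 2"
begin

abbreviation "G \<equiv> vilenkin m"
abbreviation "M \<equiv> vil_M m"
abbreviation "\<psi> \<equiv> vil_psi m"
abbreviation "r \<equiv> rademacher m"

sublocale prob_space G
  using ge2 by (rule prob_space_vilenkin)

lemma m_pos: "m k > 0"
  using ge2[of k] by simp

lemma M_pos: "M k > 0"
  unfolding vil_M_def using m_pos by (intro prod_pos) auto

lemma M_less: "i < M i"
  using ge2 by (rule vil_M_gt)

lemma M_mono: "i \<le> j \<Longrightarrow> M i \<le> M j"
  using vil_M_mono[of m, OF ge2] by simp

lemma M_dvd: "i \<le> j \<Longrightarrow> M i dvd M j"
  unfolding vil_M_def by (intro prod_dvd_prod_subset) auto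

text \<open>Each factor carries its full power set as sigma-algebra, which makes an arbitrary
  \<open>g\<close> measurable on it.\<close>

lemma measurable_coordinate [measurable]:
  "(\<lambda>x. g (x k) :: 'b::topological_space) \<in> borel_measurable G"
proof -
  have "(\<lambda>x. x k) \<in> measurable G (uniform_count_measure {..<m k})"
    unfolding vilenkin_def by (rule measurable_component_singleton) simp
  moreover have "g \<in> borel_measurable (uniform_count_measure {..<m k})"
    by (simp add: measurable_def sets_uniform_count_measure space_uniform_count_measure)
  ultimately show ?thesis
    using measurable_compose by blast
qed

lemma integrable_indicat: "A \<in> sets G \<Longrightarrow> integrable G (indicat_real A)"
  by (simp add: integrable_real_indicator emeasure_finite less_top[symmetric])

section \<open>Integrals and measures of cylinders\<close>

lemma integral_prod_coordinates:
  fixes g :: "nat \<Rightarrow> nat \<Rightarrow> 'b::{real_normed_field,banach,second_countable_topology}"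
  shows "(\<integral>x. (\<Prod>k<K. g k (x k)) \<partial>G) = (\<Prod>k<K. (\<Sum>d<m k. g k d) / of_nat (m k))"
proof -
  define U where "U k = uniform_count_measure {..<m k}" for k
  have fin: "integral\<^sup>L (U k) (g k) = (\<Sum>d<m k. g k d) / of_nat (m k)" for k
    by (simp add: U_def uniform_count_measure_def lebesgue_integral_point_measure_finite
        sum_divide_distrib scaleR_conv_of_real divide_simps)
  have prob: "prob_space (U k)" for k
    unfolding U_def using m_pos[of k]
    by (intro prob_space_uniform_count_measure) (auto simp: lessThan_empty_iff)
  interpret P: product_prob_space U UNIV
    by (intro product_prob_spaceI prob)
  have int: "integrable (U k) (g k)" for k
    by (simp add: U_def uniform_count_measure_def integrable_point_measure_finite)
  have meas: "(\<lambda>x. \<Prod>k<K. g k (x k)) \<in> borel_measurable (Pi\<^sub>M {..<K} U)"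
  proof (intro borel_measurable_prod)
    fix k assume "k \<in> {..<K}"
    then have "(\<lambda>x. x k) \<in> measurable (Pi\<^sub>M {..<K} U) (U k)"
      by (rule measurable_component_singleton)
    then show "(\<lambda>x. g k (x k)) \<in> borel_measurable (Pi\<^sub>M {..<K} U)"
      using borel_measurable_integrable[OF int] by (rule measurable_compose)
  qed
  have "(\<integral>x. (\<Prod>k<K. g k (x k)) \<partial>G) = (\<integral>x. (\<Prod>k<K. g k (restrict x {..<K} k)) \<partial>Pi\<^sub>M UNIV U)"
    by (simp add: vilenkin_def U_def[abs_def])
  also have "\<dots> = (\<integral>x. (\<Prod>k<K. g k (x k)) \<partial>distr (Pi\<^sub>M UNIV U) (Pi\<^sub>M {..<K} U) (\<lambda>x. restrict x {..<K}))"
    by (rule integral_distr[symmetric], (rule measurable_restrict_subset meas subset_UNIV)+)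
  also have "\<dots> = (\<integral>x. (\<Prod>k<K. g k (x k)) \<partial>Pi\<^sub>M {..<K} U)"
    by (subst P.distr_PiM_restrict_finite) auto
  also have "\<dots> = (\<Prod>k<K. integral\<^sup>L (U k) (g k))"
    using int by (intro P.product_integral_prod) auto
  finally show ?thesis by (simp add: fin)
qed

text \<open>The indicator of a cylinder is a product of indicators in the single coordinates, so
  \<open>integral_prod_coordinates\<close> applies.\<close>

lemma measure_coordinates:
  "measure G {x\<in>space G. \<forall>k<K. x k \<in> X k} = (\<Prod>k<K. card (X k \<inter> {..<m k}) / m k)"
  and sets_coordinates: "{x\<in>space G. \<forall>k<K. x k \<in> X k} \<in> sets G"
proof -
  have eq: "indicator {x\<in>space G. \<forall>k<K. x k \<in> X k} x = (\<Prod>k<K. indicator (X k) (x k) :: real)"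
    if "x \<in> space G" for x
    using that by (auto simp: indicator_def prod_zero_iff)
  have "{x\<in>space G. x k \<in> X k} \<in> sets G" for k
  proof -
    have "(\<lambda>x. indicator (X k) (x k) :: real) -` {1} \<inter> space G \<in> sets G"
      by (rule measurable_sets[OF measurable_coordinate]) auto
    also have "(\<lambda>x. indicator (X k) (x k) :: real) -` {1} \<inter> space G = {x\<in>space G. x k \<in> X k}"
      by (auto simp: indicator_def)
    finally show ?thesis .
  qed
  then show s: "{x\<in>space G. \<forall>k<K. x k \<in> X k} \<in> sets G"
    by (intro sets.sets_Collect_countable_All sets.sets_Collect_imp) auto
  have card: "(\<Sum>d<m k. indicator (X k) d :: real) = card (X k \<inter> {..<m k})" for k
    by (simp add: indicator_def sum.If_cases Int_commute)
  have "measure G {x\<in>space G. \<forall>k<K. x k \<in> X k}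
      = (\<integral>x. indicator {x\<in>space G. \<forall>k<K. x k \<in> X k} x \<partial>G)"
    using s by (metis (no_types, lifting) Bochner_Integration.integral_indicator sets.Int_space_eq2 measure_def)
  also have "\<dots> = (\<integral>x. (\<Prod>k<K. indicator (X k) (x k) :: real) \<partial>G)"
    by (rule Bochner_Integration.integral_cong[OF refl eq])
  also have "\<dots> = (\<Prod>k<K. card (X k \<inter> {..<m k}) / m k)"
    using integral_prod_coordinates[of "\<lambda>k d. indicator (X k) d :: real" K] by (simp only: card)
  finally show "measure G {x\<in>space G. \<forall>k<K. x k \<in> X k} = (\<Prod>k<K. card (X k \<inter> {..<m k}) / m k)" .
qed

text \<open>The interval \<open>I\<^sub>i(0)\<close>; multiplied by \<open>M i\<close>, its
  indicator is the kernel \<open>dirichlet (M i)\<close>, see \<open>dirichlet_M\<close>.\<close>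

definition zero_interval where
  "zero_interval i = {x\<in>space G. \<forall>k<i. x k = 0}"

lemma sets_zero_interval [measurable]: "zero_interval i \<in> sets G"
  using sets_coordinates[of i "\<lambda>_. {0}"] by (simp add: zero_interval_def)

lemma measure_zero_interval: "measure G (zero_interval i) = 1 / M i"
proof -
  have "{0} \<inter> {..<m k} = {0}" for k using m_pos[of k] by auto
  then show ?thesis
    using measure_coordinates[of i "\<lambda>_. {0}"]
    by (simp add: zero_interval_def vil_M_def prod_dividef)
qed

lemma digit_eq_0: "n < M k \<Longrightarrow> k \<le> l \<Longrightarrow> vil_digit m n l = 0"
  using M_mono[of k l] by (simp add: vil_digit_def)

lemma psi_eq_prod:
  assumes "n < M K"
  shows "\<psi> n x = (\<Prod>k<K. r k x ^ vil_digit m n k)"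
  unfolding vil_psi_def
proof (rule prod.mono_neutral_left)
  show "{k. vil_digit m n k \<noteq> 0} \<subseteq> {..<K}"
    using digit_eq_0[OF assms] by (force simp: not_less[symmetric])
qed auto

lemma add_less_M_Suc:
  assumes "d < m N" "j < M N"
  shows "d * M N + j < M (Suc N)"
proof -
  have "d * M N + j < d * M N + M N" using assms by simp
  also have "\<dots> = Suc d * M N" by simp
  also have "\<dots> \<le> M (Suc N)" unfolding vil_M_simps using assms by (intro mult_le_mono1) simp
  finally show ?thesis .
qed

text \<open>No carry occurs. For \<open>k < N\<close> the summand \<open>d * M N\<close> is a
  multiple of \<open>M (Suc k)\<close>, which digit \<open>k\<close> does not see; for
  \<open>k > N\<close> both numbers lie below \<open>M (Suc N)\<close>.\<close>

lemma digit_add: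
  assumes "d < m N" "j < M N"
  shows "vil_digit m (d * M N + j) k = (if k = N then d else vil_digit m j k)"
proof (cases k N rule: linorder_cases)
  case less
  then have "M (Suc k) dvd M N" by (intro M_dvd) simp
  then obtain c where "M N = M (Suc k) * c" ..
  then have c: "M N = M k * (m k * c)" by (simp add: vil_M_simps mult_ac)
  have "d * M N + j = j + d * m k * c * M k" by (simp add: c)
  then have "(d * M N + j) div M k = (j div M k) + d * m k * c"
    using M_pos[of k] by (metis add.commute div_mult_self1 less_numeral_extra(3))
  also have "\<dots> mod m k = j div M k mod m k"
    by (metis mod_mult_self2 mult.assoc mult.commute)
  finally show ?thesis using less by (simp add: vil_digit_def)
next
  case equal
  have "(d * M N + j) div M N = d" using assms(2) by simp
  then show ?thesis using assms(1) equal by (simp add: vil_digit_def)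
next
  case greater
  have "d * M N + j < M (Suc N)" using assms by (rule add_less_M_Suc)
  moreover have "j < M (Suc N)" using assms M_mono[of N "Suc N"] by simp
  ultimately show ?thesis using greater by (simp add: digit_eq_0[where k="Suc N"])
qed

text \<open>Only the digit at \<open>N\<close> changes, so a single Rademacher power splits off. All
  recursions for the kernels rest on this.\<close>

lemma psi_add:
  assumes "d < m N" "j < M N"
  shows "\<psi> (d * M N + j) x = r N x ^ d * \<psi> j x"
  using assms
  by (simp add: psi_eq_prod[OF add_less_M_Suc[OF assms]] psi_eq_prod[OF assms(2)] digit_add)

lemma norm_r [simp]: "cmod (r k x) = 1"
  by (simp add: rademacher_def norm_exp_eq_Re)

lemma norm_psi [simp]: "cmod (\<psi> n x) = 1"
  by (simp add: vil_psi_def prod_norm[symmetric] norm_power)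

lemma measurable_r [measurable]: "r k \<in> borel_measurable G"
  unfolding rademacher_def by (rule measurable_coordinate)

lemma measurable_psi [measurable]: "\<psi> n \<in> borel_measurable G"
  unfolding vil_psi_def by measurable

lemma r_eq_1: "x k = 0 \<Longrightarrow> r k x = 1"
  by (simp add: rademacher_def)

lemma r_power_m: "r k x ^ m k = 1"
proof -
  have "of_nat (m k) * (2 * of_real pi * \<i> * of_nat (x k) / of_nat (m k)) = 2 * of_real pi * \<i> * of_nat (x k)"
    using m_pos[of k] by simp
  then have "r k x ^ m k = exp (2 * of_real pi * \<i> * of_nat (x k))"
    by (simp add: rademacher_def exp_of_nat_mult[symmetric])
  also have "\<dots> = 1"
    using exp_plus_2pin[of 0 "int (x k)"] by (simp add: mult_ac)
  finally show ?thesis .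
qed

lemma exp_root_neq_1:
  assumes "0 < a" "a < n"
  shows "exp (2 * of_real pi * \<i> * of_nat a / of_nat n) \<noteq> 1"
proof
  assume "exp (2 * of_real pi * \<i> * of_nat a / of_nat n) = 1"
  then obtain l :: int where l: "2 * pi * a / n = of_int (2 * l) * pi"
    unfolding exp_eq_1 by auto
  then have "real a = of_int l * real n" using assms by (simp add: field_simps)
  then have "int a = l * int n" by (metis of_int_eq_iff of_int_mult of_int_of_nat_eq)
  then show False using assms by (metis dvd_triv_right nat_dvd_not_less of_nat_dvd_iff)
qed

lemma r_neq_1: "x \<in> space G \<Longrightarrow> x k \<noteq> 0 \<Longrightarrow> r k x \<noteq> 1"
  unfolding rademacher_def by (rule exp_root_neq_1) (auto simp: space_vilenkin)

text \<open>For \<open>x k \<noteq> 0\<close> this is a full geometric sum over a nontrivial root of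
  unity, the source of all cancellation in the kernels.\<close>

lemma sum_r_power:
  assumes "x \<in> space G"
  shows "(\<Sum>d<m k. r k x ^ d) = (if x k = 0 then of_nat (m k) else 0)"
  using r_neq_1[OF assms] r_power_m[of k x] by (auto simp: r_eq_1 sum_gp_strict)

text \<open>Dual to \<open>sum_r_power\<close>: the exponent is fixed and the point varies. The
  character is symmetric in both, so exchanging them gives a geometric sum in
  \<open>w\<close>.\<close>

lemma sum_coordinate_power:
  assumes "d < m k"
  shows "(\<Sum>a<m k. cnj (exp (2 * of_real pi * \<i> * of_nat a / of_nat (m k))) ^ d)
    = (if d = 0 then of_nat (m k) else 0)"
proof (cases "d = 0")
  case False
  define w where "w = cnj (exp (2 * of_real pi * \<i> * of_nat d / of_nat (m k)))"
  have "cnj (exp (2 * of_real pi * \<i> * of_nat a / of_nat (m k))) ^ d = w ^ a" for a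
    unfolding w_def complex_cnj_power[symmetric] exp_of_nat_mult[symmetric]
    by (simp add: field_simps)
  moreover have "w \<noteq> 1"
    using exp_root_neq_1[of d "m k"] False assms unfolding w_def
    by (metis complex_cnj_cnj complex_cnj_one not_gr_zero)
  moreover have "w ^ m k = 1"
  proof -
    have "w = cnj (r k (\<lambda>_. d))" by (simp add: w_def rademacher_def)
    then show ?thesis using r_power_m[of k "\<lambda>_. d"]
      by (metis complex_cnj_one complex_cnj_power)
  qed
  ultimately show ?thesis using False by (simp add: sum_gp_strict)
qed simp

lemma less_M_iff_digits: "j < M i \<longleftrightarrow> (\<forall>k\<ge>i. vil_digit m j k = 0)"
proof
  assume *: "\<forall>k\<ge>i. vil_digit m j k = 0"
  have "j < M (max i j)" using M_less[of j] M_mono[of j "max i j"] by simp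
  then have "j = (\<Sum>k<max i j. vil_digit m j k * M k)" by (simp add: vil_digit_partial_sum)
  also have "\<dots> = (\<Sum>k<i. vil_digit m j k * M k)"
    using * by (intro sum.mono_neutral_right) auto
  also have "\<dots> < M i" by (simp add: vil_digit_partial_sum M_pos)
  finally show "j < M i" .
qed (simp add: digit_eq_0)

text \<open>The integral factors over the coordinates. Below \<open>i\<close> the point is forced to
  be \<open>0\<close> and the factor is \<open>1\<close>; from \<open>i\<close> on the factor is
  \<open>1\<close> or \<open>0\<close> according to whether the digit of \<open>j\<close>
  vanishes.\<close>

lemma integral_zero_interval_psi:
  "(\<integral>x. of_real (M i * indicat_real (zero_interval i) x) * cnj (\<psi> j x) \<partial>G) = (if j < M i then 1 else 0)"
proof -
  \<comment> \<open>Large enough for the \<open>i\<close> constrained coordinates and, since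
    \<open>j < M j\<close>, for all nonzero digits of \<open>j\<close>.\<close>
  define K where "K = max i j"
  have jK: "j < M K" using M_less[of j] M_mono[of j K] by (simp add: K_def)
  define g :: "nat \<Rightarrow> nat \<Rightarrow> complex" where
    "g k a = (if k < i then of_nat (m k) * indicator {0} a else 1)
      * cnj (exp (2 * of_real pi * \<i> * of_nat a / of_nat (m k))) ^ vil_digit m j k" for k a
  have Mi: "of_nat (M i) * indicator (zero_interval i) x
      = (\<Prod>k<K. if k < i then of_nat (m k) * indicator {0} (x k) else 1 :: complex)"
    if "x \<in> space G" for x
  proof -
    have "(\<Prod>k<K. if k < i then of_nat (m k) * indicator {0} (x k) else 1)
        = (\<Prod>k<i. of_nat (m k) * indicator {0} (x k) :: complex)"
      by (intro prod.mono_neutral_cong_right) (auto simp: K_def)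
    also have "\<dots> = of_nat (M i) * (\<Prod>k<i. indicator {0} (x k))"
      by (simp add: prod.distrib vil_M_def)
    also have "(\<Prod>k<i. indicator {0} (x k)) = (indicator (zero_interval i) x :: complex)"
      using that by (auto simp: zero_interval_def indicator_def prod_zero_iff)
    finally show ?thesis ..
  qed
  have "(\<integral>x. of_real (M i * indicat_real (zero_interval i) x) * cnj (\<psi> j x) \<partial>G)
      = (\<integral>x. (\<Prod>k<K. g k (x k)) \<partial>G)"
  proof (rule Bochner_Integration.integral_cong[OF refl])
    fix x assume x: "x \<in> space G"
    have "of_real (M i * indicat_real (zero_interval i) x) = of_nat (M i) * (indicator (zero_interval i) x :: complex)"
      by (simp add: indicator_def)
    then show "of_real (M i * indicat_real (zero_interval i) x) * cnj (\<psi> j x) = (\<Prod>k<K. g k (x k))"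
      unfolding psi_eq_prod[OF jK] g_def prod.distrib
      by (simp add: Mi[OF x] rademacher_def)
  qed
  also have "\<dots> = (\<Prod>k<K. (\<Sum>a<m k. g k a) / of_nat (m k))"
    by (rule integral_prod_coordinates)
  also have "\<dots> = (\<Prod>k<K. if k < i \<or> vil_digit m j k = 0 then 1 else 0)"
  proof (rule prod.cong[OF refl])
    fix k
    show "(\<Sum>a<m k. g k a) / of_nat (m k) = (if k < i \<or> vil_digit m j k = 0 then 1 else 0)"
    proof (cases "k < i")
      case True
      have "(\<Sum>a<m k. g k a) = (\<Sum>a<m k. if a = 0 then of_nat (m k) else 0)"
        using True by (intro sum.cong) (auto simp: g_def)
      then show ?thesis using True m_pos[of k] by (simp add: sum.delta)
    next
      case False
      have "(\<Sum>a<m k. g k a) = (if vil_digit m j k = 0 then of_nat (m k) else 0)"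
        using False vil_digit_less[of m j k, OF ge2] by (simp add: g_def sum_coordinate_power)
      then show ?thesis using False m_pos[of k] by simp
    qed
  qed
  also have "\<dots> = (if j < M i then 1 else 0)"
  proof (cases "j < M i")
    case True
    then show ?thesis
      by (auto intro!: prod.neutral simp: less_M_iff_digits) (metis not_less not_gr_zero)
  next
    case False
    then obtain k where k: "k \<ge> i" "vil_digit m j k \<noteq> 0" by (auto simp: less_M_iff_digits)
    then have "k < K" using digit_eq_0[OF jK, of k] by (metis not_le)
    with k have "(\<Prod>k<K. if k < i \<or> vil_digit m j k = 0 then 1 else 0 :: complex) = 0"
      by (intro prod_zero) (auto intro!: bexI[of _ k])
    with False show ?thesis by simp
  qed
  finally show ?thesis .
qed

subsection \<open>Kernels\<close>

definition dirichlet :: "nat \<Rightarrow> (nat \<Rightarrow> nat) \<Rightarrow> complex" where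
  "dirichlet n x = (\<Sum>j<n. \<psi> j x)"

text \<open>This is \<open>n\<close> times the Fejer kernel; without the division the recursions
  contain no quotients.\<close>

definition dirichlet_sum :: "nat \<Rightarrow> (nat \<Rightarrow> nat) \<Rightarrow> complex" where
  "dirichlet_sum n x = (\<Sum>i<n. dirichlet i x)"

lemma measurable_dirichlet [measurable]: "dirichlet n \<in> borel_measurable G"
  unfolding dirichlet_def by measurable

lemma measurable_dirichlet_sum [measurable]: "dirichlet_sum n \<in> borel_measurable G"
  unfolding dirichlet_sum_def by measurable

lemma norm_dirichlet_le: "cmod (dirichlet n x) \<le> n"
  unfolding dirichlet_def using sum_norm_le[of "{..<n}" "\<lambda>j. \<psi> j x" "\<lambda>_. 1"] by simp

lemma norm_dirichlet_sum_le: "cmod (dirichlet_sum n x) \<le> (real n)\<^sup>2"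
proof -
  have "cmod (dirichlet i x) \<le> n" if "i < n" for i
    using norm_dirichlet_le[of i x] that by linarith
  then show ?thesis
    unfolding dirichlet_sum_def
    using sum_norm_le[of "{..<n}" "\<lambda>i. dirichlet i x" "\<lambda>_. real n"] by (simp add: power2_eq_square)
qed

lemma dirichlet_add_aux:
  assumes "d < m s" "j \<le> M s"
  shows "dirichlet (d * M s + j) x = dirichlet (d * M s) x + r s x ^ d * dirichlet j x"
  unfolding dirichlet_def sum_lessThan_add
  using assms by (simp add: psi_add sum_distrib_left)

lemma dirichlet_mult:
  "d \<le> m s \<Longrightarrow> dirichlet (d * M s) x = (\<Sum>e<d. r s x ^ e) * dirichlet (M s) x"
proof (induction d)
  case (Suc d)
  then show ?case
    using dirichlet_add_aux[of d s "M s" x] by (simp add: algebra_simps)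
qed (simp add: dirichlet_def)

lemma dirichlet_add:
  assumes "d < m s" "j \<le> M s"
  shows "dirichlet (d * M s + j) x = (\<Sum>e<d. r s x ^ e) * dirichlet (M s) x + r s x ^ d * dirichlet j x"
  using assms by (simp add: dirichlet_add_aux dirichlet_mult)

text \<open>Paley's formula: passing to \<open>Suc s\<close> multiplies the kernel by a geometric
  sum that is \<open>m s\<close> where \<open>x s = 0\<close> and \<open>0\<close>
  elsewhere.\<close>

lemma dirichlet_M:
  assumes "x \<in> space G"
  shows "dirichlet (M s) x = of_nat (M s) * indicator (zero_interval s) x"
proof (induction s)
  case 0
  have "\<psi> 0 x = 1" by (simp add: vil_psi_def vil_digit_def)
  then show ?case using assms by (simp add: dirichlet_def vil_M_simps zero_interval_def)
next
  case (Suc s)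
  have "dirichlet (M (Suc s)) x = (\<Sum>e<m s. r s x ^ e) * dirichlet (M s) x"
    using dirichlet_mult[of "m s" s x] by (simp add: vil_M_simps)
  then show ?case
    using assms by (auto simp: Suc sum_r_power vil_M_simps indicator_def zero_interval_def less_Suc_eq)
qed

lemma dirichlet_sum_add:
  assumes "q \<le> M s"
  shows "dirichlet_sum (M s + q) x = dirichlet_sum (M s) x + of_nat q * dirichlet (M s) x
    + r s x * dirichlet_sum q x"
  using assms dirichlet_add[of 1 s _ x] ge2[of s]
  by (simp add: dirichlet_sum_def sum_lessThan_add sum.distrib sum_distrib_left)

lemma dirichlet_sum_mult:
  "d \<le> m s \<Longrightarrow> dirichlet_sum (d * M s) x
    = of_nat (M s) * dirichlet (M s) x * (\<Sum>i<d. \<Sum>e<i. r s x ^ e)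
      + (\<Sum>i<d. r s x ^ i) * dirichlet_sum (M s) x"
proof (induction d)
  case (Suc d)
  have "dirichlet_sum (Suc d * M s) x = dirichlet_sum (d * M s) x + (\<Sum>i<M s. dirichlet (d * M s + i) x)"
    using sum_lessThan_add[of "\<lambda>i. dirichlet i x" "d * M s" "M s"]
    by (simp add: dirichlet_sum_def add.commute)
  also have "(\<Sum>i<M s. dirichlet (d * M s + i) x)
      = of_nat (M s) * (\<Sum>e<d. r s x ^ e) * dirichlet (M s) x + r s x ^ d * dirichlet_sum (M s) x"
    using Suc.prems by (simp add: dirichlet_add dirichlet_sum_def sum.distrib sum_distrib_left)
  finally show ?case using Suc by (simp add: algebra_simps)
qed (simp add: dirichlet_sum_def)

text \<open>Case \<open>d = m s\<close> of the previous recursion. On \<open>space G\<close> the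
  first term lives on \<open>zero_interval s\<close>, and the second vanishes where
  \<open>x s \<noteq> 0\<close>.\<close>

lemma dirichlet_sum_M_Suc:
  "dirichlet_sum (M (Suc s)) x
    = of_nat (M s) * dirichlet (M s) x * (\<Sum>i<m s. \<Sum>e<i. r s x ^ e)
      + (\<Sum>i<m s. r s x ^ i) * dirichlet_sum (M s) x"
  using dirichlet_sum_mult[of "m s" s x] by (simp add: vil_M_simps)

definition sparse_set :: "nat \<Rightarrow> (nat \<Rightarrow> nat) set" where
  "sparse_set s = {x\<in>space G. \<forall>k<s. \<forall>l<s. k \<noteq> l \<longrightarrow> x k = 0 \<or> x l = 0}"

lemma zero_interval_subset_sparse: "zero_interval s \<subseteq> sparse_set s"
  by (auto simp: zero_interval_def sparse_set_def)

text \<open>Of two nonzero coordinates below \<open>Suc s\<close> at least one lies below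
  \<open>s\<close>, which kills the first term of \<open>dirichlet_sum_M_Suc\<close>. The second
  dies by the geometric sum if \<open>x s \<noteq> 0\<close>, and by induction otherwise.\<close>

lemma dirichlet_sum_M_eq_0:
  assumes "x \<in> space G"
  shows "x \<notin> sparse_set s \<Longrightarrow> dirichlet_sum (M s) x = 0"
proof (induction s)
  case (Suc s)
  then obtain k l where kl: "k < Suc s" "l < Suc s" "k \<noteq> l" "x k \<noteq> 0" "x l \<noteq> 0"
    using assms by (auto simp: sparse_set_def)
  then have "x \<notin> zero_interval s"
    by (auto simp: zero_interval_def less_Suc_eq)
  then have D: "dirichlet (M s) x = 0" by (simp add: dirichlet_M[OF assms])
  show ?case
  proof (cases "x s = 0")
    case True
    then have "k < s" "l < s" using kl by (auto simp: less_Suc_eq)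
    with kl have "x \<notin> sparse_set s" by (auto simp: sparse_set_def)
    then show ?thesis using Suc.IH D by (simp add: dirichlet_sum_M_Suc)
  qed (simp add: dirichlet_sum_M_Suc D sum_r_power[OF assms])
qed (use assms in \<open>simp add: sparse_set_def\<close>)

text \<open>Only the first term of \<open>dirichlet_sum_M_Suc\<close> survives, with
  \<open>dirichlet (M s) x = M s\<close>; it remains to bound the double sum of powers below by
  \<open>1\<close>.\<close>

lemma dirichlet_sum_M_Suc_ge:
  assumes "x \<in> zero_interval s" "x s \<noteq> 0"
  shows "cmod (dirichlet_sum (M (Suc s)) x) \<ge> (real (M s))\<^sup>2"
proof -
  have x: "x \<in> space G" using assms by (simp add: zero_interval_def)
  define w where "w = r s x"
  have w: "w \<noteq> 1" "cmod w = 1" "(\<Sum>i<m s. w ^ i) = 0"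
    using r_neq_1[OF x assms(2)] sum_r_power[OF x, of s] assms(2) by (auto simp: w_def)
  \<comment> \<open>The factor \<open>w - 1\<close> telescopes the inner sums; as its modulus is at
    most \<open>2\<close>, the double sum has modulus at least \<open>m s / 2\<close>.\<close>
  have "(w - 1) * (\<Sum>i<m s. \<Sum>e<i. w ^ e) = (\<Sum>i<m s. w ^ i - 1)"
    by (simp add: sum_distrib_left power_diff_1_eq)
  also have "\<dots> = - of_nat (m s)" using w by (simp add: sum_subtractf)
  finally have "cmod (w - 1) * cmod (\<Sum>i<m s. \<Sum>e<i. w ^ e) = m s"
    by (metis norm_mult norm_minus_cancel norm_of_nat)
  moreover have "cmod (w - 1) \<le> 2" using norm_triangle_ineq4[of w 1] w by simp
  ultimately have "real (m s) \<le> 2 * cmod (\<Sum>i<m s. \<Sum>e<i. w ^ e)"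
    by (metis mult_right_mono norm_ge_zero)
  then have "1 \<le> cmod (\<Sum>i<m s. \<Sum>e<i. w ^ e)" using ge2[of s] by linarith
  then have "(real (M s))\<^sup>2 * 1 \<le> (real (M s))\<^sup>2 * cmod (\<Sum>i<m s. \<Sum>e<i. w ^ e)"
    by (intro mult_left_mono) auto
  also have "\<dots> = cmod (dirichlet_sum (M (Suc s)) x)"
    using assms(1) w(3)
    by (simp add: dirichlet_sum_M_Suc dirichlet_M[OF x] w_def norm_mult power2_eq_square)
  finally show ?thesis by simp
qed

lemma sets_sparse_set [measurable]: "sparse_set s \<in> sets G"
proof -
  have "{x\<in>space G. x k = 0} \<in> sets G" for k
    using sets_coordinates[of "Suc k" "\<lambda>l. if l = k then {0} else UNIV"]
    by (simp add: if_split less_Suc_eq conj_commute cong: conj_cong)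
  then show ?thesis
    unfolding sparse_set_def
    by (intro sets.sets_Collect_countable_All sets.sets_Collect_imp sets.sets_Collect_disj) auto
qed

text \<open>The set is covered by the \<open>s\<close> sets \<open>A t\<close> on which all
  coordinates below \<open>s\<close> except the one at \<open>t\<close> vanish; each of the other
  \<open>s - 1\<close> coordinates costs a factor of at most \<open>1/2\<close>.\<close>

lemma measure_sparse_set:
  assumes "s > 0"
  shows "measure G (sparse_set s) \<le> s / 2 ^ (s - 1)"
proof -
  define A where "A t = {x\<in>space G. \<forall>k<s. x k \<in> (if k = t then UNIV else {0})}" for t
  have A: "A t \<in> sets G" for t unfolding A_def by (rule sets_coordinates)
  have mA: "measure G (A t) \<le> (1/2) ^ (s - 1)" if "t < s" for t
  proof -
    have "measure G (A t) = (\<Prod>k<s. card ((if k = t then UNIV else {0}) \<inter> {..<m k}) / m k)"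
      unfolding A_def by (rule measure_coordinates)
    also have "\<dots> \<le> (\<Prod>k<s. if k = t then 1 else 1/2)"
    proof (rule prod_mono, intro conjI)
      fix k
      have "{0} \<inter> {..<m k} = {0}" using m_pos[of k] by auto
      then show "card ((if k = t then UNIV else {0}) \<inter> {..<m k}) / m k \<le> (if k = t then 1 else 1/2 :: real)"
        using ge2[of k] by (simp add: divide_simps)
    qed auto
    also have "\<dots> = (1/2) ^ card ({..<s} - {t})"
      using that by (subst prod.remove[of _ t]) auto
    also have "card ({..<s} - {t}) = s - 1" using that by simp
    finally show ?thesis .
  qed
  have "sparse_set s \<subseteq> (\<Union>t<s. A t)"
  proof
    fix x assume x: "x \<in> sparse_set s"
    show "x \<in> (\<Union>t<s. A t)"
    proof (cases "\<exists>t<s. x t \<noteq> 0")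
      case True
      then obtain t where "t < s" "x t \<noteq> 0" by blast
      with x have "x \<in> A t" by (auto simp: sparse_set_def A_def)
      then show ?thesis using \<open>t < s\<close> by blast
    next
      case False
      then have "x \<in> A 0" using x by (auto simp: sparse_set_def A_def)
      then show ?thesis using assms by blast
    qed
  qed
  then have "measure G (sparse_set s) \<le> measure G (\<Union>t<s. A t)"
    using A by (intro finite_measure_mono) auto
  also have "\<dots> \<le> (\<Sum>t<s. measure G (A t))"
    using A by (intro measure_UNION_le) (auto simp: fmeasurable_eq_sets)
  also have "\<dots> \<le> (\<Sum>t<s. (1/2) ^ (s - 1))"
    using mA by (intro sum_mono) auto
  finally show ?thesis by (simp add: power_divide)
qed

section \<open>Unboundedness of the kernels for the exponent 1/2\<close>

definition root_integral :: "((nat \<Rightarrow> nat) \<Rightarrow> complex) \<Rightarrow> real" where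
  "root_integral h = (\<integral>x. sqrt (cmod (h x)) \<partial>G)"

lemma integrable_sqrt_norm:
  assumes [measurable]: "h \<in> borel_measurable G" and bound: "\<And>x. cmod (h x) \<le> B"
  shows "integrable G (\<lambda>x. sqrt (cmod (h x)))"
proof (rule integrable_const_bound[where B="sqrt B"])
  show "AE x in G. norm (sqrt (cmod (h x))) \<le> sqrt B"
    using bound by (auto intro: real_sqrt_le_mono)
qed measurable

lemma integrable_sqrt_dirichlet_sum: "integrable G (\<lambda>x. sqrt (cmod (dirichlet_sum q x)))"
  using norm_dirichlet_sum_le by (rule integrable_sqrt_norm[OF measurable_dirichlet_sum])

text \<open>Outside the sparse set the new digit leaves the modulus unchanged. On the subset
  \<open>E\<close> the new terms gain \<open>M s\<close> in the square root, in total at least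
  \<open>1/2\<close>; the subtracted term pays for interference with
  \<open>dirichlet_sum q\<close>.\<close>

lemma root_integral_dirichlet_sum_add:
  assumes "q \<le> M (Suc s)"
  shows "root_integral (dirichlet_sum (M (Suc s) + q))
    \<ge> root_integral (dirichlet_sum q) + 1/2 - 2 * q * measure G (sparse_set (Suc s))"
proof -
  \<comment> \<open>Here \<open>dirichlet (M (Suc s))\<close> vanishes, while
    \<open>dirichlet_sum_M_Suc_ge\<close> applies.\<close>
  define E where "E = zero_interval s - zero_interval (Suc s)"
  have [measurable]: "E \<in> sets G" by (simp add: E_def)
  let ?S = "sparse_set (Suc s)"
  have E: "x \<in> zero_interval s" "x s \<noteq> 0" if "x \<in> E" for x
    using that by (auto simp: E_def zero_interval_def less_Suc_eq)
  have ES: "E \<subseteq> ?S"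
    using E by (force simp: zero_interval_def sparse_set_def less_Suc_eq)
  have muE: "M s * measure G E \<ge> 1/2"
  proof -
    have "measure G E = measure G (zero_interval s) - measure G (zero_interval (Suc s))"
      unfolding E_def by (intro finite_measure_Diff) (auto simp: zero_interval_def)
    then have "M s * measure G E = 1 - 1 / m s"
      using M_pos[of s] m_pos[of s] by (simp add: measure_zero_interval vil_M_simps field_simps)
    moreover have "1 / real (m s) \<le> 1 / 2" using ge2[of s] by (simp add: field_simps)
    ultimately show ?thesis by linarith
  qed
  \<comment> \<open>The root of \<open>cmod (dirichlet_sum q x)\<close> is at most \<open>q\<close>
    and enters twice on the sparse set: as the first summand and through the triangle inequality.
    Hence the factor \<open>2\<close>.\<close>
  have pointwise: "sqrt (cmod (dirichlet_sum q x)) + M s * indicat_real E x - 2 * q * indicat_real ?S x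
      \<le> sqrt (cmod (dirichlet_sum (M (Suc s) + q) x))" if x: "x \<in> space G" for x
  proof -
    define g where "g = dirichlet_sum (M (Suc s)) x + of_nat q * dirichlet (M (Suc s)) x"
    have eq: "dirichlet_sum (M (Suc s) + q) x = g + r (Suc s) x * dirichlet_sum q x"
      unfolding g_def using assms by (rule dirichlet_sum_add)
    have q: "sqrt (cmod (dirichlet_sum q x)) \<le> q"
      using norm_dirichlet_sum_le[of q x] by (simp add: real_le_lsqrt)
    show ?thesis
    proof (cases "x \<in> ?S")
      case False
      then have "g = 0"
        using zero_interval_subset_sparse[of "Suc s"] x
        by (auto simp: g_def dirichlet_sum_M_eq_0 dirichlet_M indicator_def)
      then show ?thesis using False ES by (auto simp: eq norm_mult indicator_def)
    next
      case True
      have "M s * indicat_real E x \<le> sqrt (cmod g)"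
      proof (cases "x \<in> E")
        case True
        then have "dirichlet (M (Suc s)) x = 0"
          using x by (simp add: dirichlet_M E_def)
        then show ?thesis
          using dirichlet_sum_M_Suc_ge[OF E[OF True]] True by (simp add: g_def real_le_rsqrt)
      qed simp
      also have "\<dots> \<le> sqrt (cmod (dirichlet_sum (M (Suc s) + q) x) + cmod (dirichlet_sum q x))"
        using norm_triangle_ineq4[of "dirichlet_sum (M (Suc s) + q) x" "r (Suc s) x * dirichlet_sum q x"]
        by (intro real_sqrt_le_mono) (simp add: eq norm_mult)
      also have "\<dots> \<le> sqrt (cmod (dirichlet_sum (M (Suc s) + q) x)) + sqrt (cmod (dirichlet_sum q x))"
        by (intro sqrt_add_le_add_sqrt) auto
      finally show ?thesis using q True by simp
    qed
  qed
  have "(\<integral>x. sqrt (cmod (dirichlet_sum q x)) + M s * indicat_real E x - 2 * q * indicat_real ?S x \<partial>G)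
      \<le> root_integral (dirichlet_sum (M (Suc s) + q))"
    unfolding root_integral_def
  proof (rule integral_mono)
    show "integrable G (\<lambda>x. sqrt (cmod (dirichlet_sum q x)) + M s * indicat_real E x
        - 2 * q * indicat_real ?S x)"
      by (intro Bochner_Integration.integrable_add Bochner_Integration.integrable_diff
          integrable_mult_right integrable_indicat integrable_sqrt_dirichlet_sum) measurable
  qed (use pointwise integrable_sqrt_dirichlet_sum in auto)
  also have "(\<integral>x. sqrt (cmod (dirichlet_sum q x)) + M s * indicat_real E x - 2 * q * indicat_real ?S x \<partial>G)
      = root_integral (dirichlet_sum q) + M s * measure G E - 2 * q * measure G ?S"
    using integrable_sqrt_dirichlet_sum[of q] by (simp add: root_integral_def integrable_indicat)
  finally show ?thesis using muE by linarith
qed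

text \<open>Each new digit gains \<open>1/2\<close>; its position is chosen after \<open>q\<close>,
  so far out that at most \<open>1/4\<close> is lost again.\<close>

lemma root_integral_dirichlet_sum_unbounded: "\<exists>q. root_integral (dirichlet_sum q) \<ge> R"
proof -
  have "\<exists>q. root_integral (dirichlet_sum q) \<ge> n / 4" for n :: nat
  proof (induction n)
    case 0
    show ?case by (auto simp: root_integral_def)
  next
    case (Suc n)
    then obtain q where q: "root_integral (dirichlet_sum q) \<ge> n / 4" by blast
    \<comment> \<open>The fraction is the bound of \<open>measure_sparse_set\<close> at
      \<open>Suc s\<close>.\<close>
    have "((\<lambda>s. 2 * q * (real (Suc s) / 2 ^ s)) \<longlongrightarrow> 0) sequentially"
      by real_asymp
    then have "\<forall>\<^sub>F s in sequentially. 2 * q * (real (Suc s) / 2 ^ s) < 1/4"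
      by (rule order_tendstoD) simp
    moreover have "\<forall>\<^sub>F s in sequentially. q \<le> s" by (rule eventually_ge_at_top)
    ultimately obtain s where s: "2 * q * (real (Suc s) / 2 ^ s) < 1/4" "q \<le> s"
      using eventually_happens'[OF sequentially_bot eventually_conj] by blast
    have "2 * q * measure G (sparse_set (Suc s)) \<le> 2 * q * (real (Suc s) / 2 ^ s)"
      using measure_sparse_set[of "Suc s"] by (intro mult_left_mono) auto
    moreover have "Suc n / 4 = n / 4 + 1 / (4::real)" by (simp add: field_simps)
    moreover have "real (2 * q) = 2 * real q" by simp
    ultimately have "root_integral (dirichlet_sum (M (Suc s) + q)) \<ge> Suc n / 4"
      using root_integral_dirichlet_sum_add[of q s] M_less[of "Suc s"] s q
      by linarith
    then show ?case by blast
  qed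
  moreover obtain n :: nat where "R * 4 \<le> n" using real_arch_simple by blast
  ultimately show ?thesis by (metis le_divide_eq_numeral1(1) order_trans)
qed

subsection \<open>Martingales built from blocks\<close>

lemma zero_interval_antimono: "i \<le> j \<Longrightarrow> zero_interval j \<subseteq> zero_interval i"
  by (auto simp: zero_interval_def)

lemma sets_filtration:
  "sets (vil_filtration m n) = sigma_sets (space G) {vil_interval m n x | x. x \<in> space G}"
  unfolding vil_filtration_def by (rule sets_measure_of) (auto simp: vil_interval_def)

text \<open>A union of intervals of level \<open>n\<close>, finitely many since each is determined
  by its first \<open>n\<close> coordinates.\<close>

lemma zero_interval_in_filtration:
  assumes "i \<le> n"
  shows "zero_interval i \<in> sets (vil_filtration m n)"
proof -
  let ?I = "vil_interval m n ` zero_interval i"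
  have "?I \<subseteq> (\<lambda>u. {y \<in> space G. \<forall>k<n. y k = u k}) ` PiE {..<n} (\<lambda>k. {..<m k})"
  proof
    fix J assume "J \<in> ?I"
    then obtain x where x: "x \<in> space G" "J = vil_interval m n x"
      by (auto simp: zero_interval_def)
    then have "J = {y \<in> space G. \<forall>k<n. y k = restrict x {..<n} k}"
      by (auto simp: vil_interval_def)
    moreover have "restrict x {..<n} \<in> PiE {..<n} (\<lambda>k. {..<m k})"
      using x by (auto simp: space_vilenkin)
    ultimately show "J \<in> (\<lambda>u. {y \<in> space G. \<forall>k<n. y k = u k}) ` PiE {..<n} (\<lambda>k. {..<m k})"
      by blast
  qed
  then have "finite ?I" by (rule finite_subset) (simp add: finite_PiE)
  moreover have "J \<in> sets (vil_filtration m n)" if "J \<in> ?I" for J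
    using that unfolding sets_filtration by (auto simp: zero_interval_def intro!: sigma_sets.Basic)
  ultimately have "\<Union>?I \<in> sets (vil_filtration m n)"
    by (intro sets.finite_Union) auto
  also have "\<Union>?I = zero_interval i"
    using assms by (auto simp: vil_interval_def zero_interval_def)
  finally show ?thesis .
qed

text \<open>Containing or missing \<open>zero_interval n\<close> holds for the generators and is
  preserved by complements and countable unions.\<close>

lemma filtration_atom:
  assumes "A \<in> sets (vil_filtration m n)"
  shows "zero_interval n \<subseteq> A \<or> zero_interval n \<inter> A = {}"
  using assms unfolding sets_filtration
proof (induction rule: sigma_sets.induct)
  case (Basic a)
  then obtain x where "a = vil_interval m n x" by blast
  then show ?case by (cases "\<forall>k<n. x k = 0") (auto simp: vil_interval_def zero_interval_def)
next
  case (Compl a)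
  then show ?case by (auto simp: zero_interval_def)
qed auto

text \<open>Partial sums of \<open>c i\<close> times differences of the kernels
  \<open>dirichlet (M i)\<close>, written by Paley's formula to stay real. Sparse positions are
  encoded by zeros of \<open>c\<close>; the range \<open>i < n\<close> keeps all intervals in the
  \<open>n\<close>-th sigma-algebra.\<close>

definition block_martingale :: "(nat \<Rightarrow> real) \<Rightarrow> nat \<Rightarrow> (nat \<Rightarrow> nat) \<Rightarrow> real" where
  "block_martingale c n x = (\<Sum>i<n. c i * (M (Suc i) * indicat_real (zero_interval (Suc i)) x
     - M i * indicat_real (zero_interval i) x))"

lemma integrable_block_martingale [simp]: "integrable G (block_martingale c n)"
  unfolding block_martingale_def
  by (intro Bochner_Integration.integrable_sum integrable_mult_right Bochner_Integration.integrable_diff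
      integrable_indicat sets_zero_interval)

text \<open>By \<open>filtration_atom\<close> the set \<open>A\<close> carries all or nothing of the
  mass \<open>1\<close> of the normalised indicator. The value is the same for all
  \<open>i \<ge> n\<close>, so later increments of a block martingale integrate to \<open>0\<close>
  over \<open>A\<close>.\<close>

lemma set_integral_indicator_zero_interval:
  assumes "A \<in> sets (vil_filtration m n)" "n \<le> i"
  shows "(\<integral>x\<in>A. M i * indicat_real (zero_interval i) x \<partial>G) = (if zero_interval n \<subseteq> A then 1 else 0)"
proof -
  have "(\<integral>x\<in>A. M i * indicat_real (zero_interval i) x \<partial>G)
      = (\<integral>x. (if zero_interval n \<subseteq> A then M i else 0) * indicat_real (zero_interval i) x \<partial>G)"
    unfolding set_lebesgue_integral_def
  proof (rule Bochner_Integration.integral_cong[OF refl])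
    fix x
    show "indicat_real A x *\<^sub>R (M i * indicat_real (zero_interval i) x)
      = (if zero_interval n \<subseteq> A then M i else 0) * indicat_real (zero_interval i) x"
      using filtration_atom[OF assms(1)] zero_interval_antimono[OF assms(2)]
      by (cases "zero_interval n \<subseteq> A"; cases "x \<in> zero_interval i"; cases "x \<in> A") auto
  qed
  also have "\<dots> = (if zero_interval n \<subseteq> A then 1 else 0)"
    using M_pos[of i] by (simp add: measure_zero_interval)
  finally show ?thesis .
qed

lemma set_integral_block_martingale:
  assumes A: "A \<in> sets (vil_filtration m n)" and "n \<le> k"
  shows "(\<integral>x\<in>A. block_martingale c k x \<partial>G) = (\<integral>x\<in>A. block_martingale c n x \<partial>G)"
  using assms(2)
proof (induction k rule: dec_induct)
  case (step k)
  have A': "A \<in> sets G"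
    using A subalgebra_vil_filtration[of m n] by (auto simp: subalgebra_def)
  have int: "set_integrable G A f" if "integrable G f" for f :: "_ \<Rightarrow> real"
    using integrable_mult_indicator[OF A' that] by (simp add: set_integrable_def)
  have e: "integrable G (\<lambda>x. M i * indicat_real (zero_interval i) x)" for i
    by (intro integrable_mult_right integrable_indicat sets_zero_interval)
  have "(\<integral>x\<in>A. block_martingale c (Suc k) x \<partial>G) = (\<integral>x\<in>A. block_martingale c k x
      + c k * (M (Suc k) * indicat_real (zero_interval (Suc k)) x - M k * indicat_real (zero_interval k) x) \<partial>G)"
    by (simp add: block_martingale_def)
  also have "\<dots> = (\<integral>x\<in>A. block_martingale c k x \<partial>G)
    + c k * ((\<integral>x\<in>A. M (Suc k) * indicat_real (zero_interval (Suc k)) x \<partial>G)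
      - (\<integral>x\<in>A. M k * indicat_real (zero_interval k) x \<partial>G))"
    using int[OF e] int[OF integrable_block_martingale]
    by (subst set_integral_add set_integral_mult_right set_integral_diff;
        (intro set_integral_add set_integral_diff set_integrable_mult_right)?; simp)+
  also have "\<dots> = (\<integral>x\<in>A. block_martingale c k x \<partial>G)"
    using step by (simp only: set_integral_indicator_zero_interval[OF A] le_SucI) simp
  finally show ?case using step by simp
qed simp

lemma measurable_block_martingale: "block_martingale c n \<in> borel_measurable (vil_filtration m n)"
proof -
  have "indicat_real (zero_interval i) \<in> borel_measurable (vil_filtration m n)" if "i \<le> n" for i
    using zero_interval_in_filtration[OF that] by simp
  then show ?thesis
    unfolding block_martingale_def
    by (intro borel_measurable_sum borel_measurable_times borel_measurable_diff borel_measurable_const) auto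
qed

lemma vil_martingale_block: "vil_martingale m (\<lambda>n x. of_real (block_martingale c n x))"
  unfolding vil_martingale_def
proof (intro conjI allI impI)
  fix n
  show "(\<lambda>x. complex_of_real (block_martingale c n x)) \<in> borel_measurable (vil_filtration m n)"
    using measurable_block_martingale by measurable
  show "integrable G (\<lambda>x. complex_of_real (block_martingale c n x))"
    by (simp add: integrable_of_real)
next
  fix n k :: nat assume nk: "n \<le> k"
  interpret S: finite_measure_subalgebra G "vil_filtration m n"
    by unfold_locales (rule subalgebra_vil_filtration)
  have "AE x in G. real_cond_exp G (vil_filtration m n) (block_martingale c k) x = block_martingale c n x"
    using nk by (intro S.real_cond_exp_charact set_integral_block_martingale measurable_block_martingale) auto
  moreover have "AE x in G. real_cond_exp G (vil_filtration m n) (\<lambda>_. 0) x = 0"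
    by (intro S.real_cond_exp_charact) auto
  ultimately show "AE x in G.
      real_cond_exp G (vil_filtration m n) (\<lambda>y. Re (complex_of_real (block_martingale c k y))) x
        = Re (complex_of_real (block_martingale c n x)) \<and>
      real_cond_exp G (vil_filtration m n) (\<lambda>y. Im (complex_of_real (block_martingale c k y))) x
        = Im (complex_of_real (block_martingale c n x))"
    by (auto elim!: AE_mp)
qed

section \<open>Fourier coefficients and Fejer means of block martingales\<close>

definition block_coeff :: "(nat \<Rightarrow> real) \<Rightarrow> nat \<Rightarrow> real" where
  "block_coeff c j = (\<Sum>i\<le>j. if M i \<le> j \<and> j < M (Suc i) then c i else 0)"

lemma M_block_unique: "M i \<le> j \<Longrightarrow> j < M (Suc i) \<Longrightarrow> M k \<le> j \<Longrightarrow> j < M (Suc k) \<Longrightarrow> i = k"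
  using M_mono[of "Suc i" k] M_mono[of "Suc k" i] by (cases i k rule: linorder_cases) auto

lemma block_coeff_eq:
  assumes "M N \<le> j" "j < M (Suc N)"
  shows "block_coeff c j = c N"
proof -
  have "block_coeff c j = (\<Sum>i\<le>j. if i = N then c i else 0)"
    unfolding block_coeff_def using assms M_block_unique by (intro sum.cong) auto
  moreover have "N \<le> j" using M_less[of N] assms by simp
  ultimately show ?thesis by simp
qed

text \<open>By \<open>integral_zero_interval_psi\<close> the \<open>i\<close>-th increment has
  coefficient \<open>c i\<close> exactly on the block \<open>M i \<le> j < M (Suc i)\<close>. Only
  increments with \<open>i \<le> j\<close> matter, so the sequence under the limit is constant for
  \<open>k > j\<close>.\<close>

lemma vil_coeff_block:
  "vil_coeff m (\<lambda>n x. of_real (block_martingale c n x)) j = of_real (block_coeff c j)"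
proof -
  define e where "e i x = complex_of_real (M i * indicat_real (zero_interval i) x) * cnj (\<psi> j x)" for i x
  have int: "integrable G (e i)" for i
  proof (rule integrable_const_bound[where B="M i"])
    show "AE x in G. norm (e i x) \<le> M i"
      by (intro AE_I2) (simp add: e_def norm_mult indicator_def)
    have "(\<lambda>x. cnj (\<psi> j x)) \<in> borel_measurable G"
      by (rule borel_measurable_continuous_on[OF _ measurable_psi]) (intro continuous_intros)
    moreover have "(\<lambda>x. complex_of_real (M i * indicat_real (zero_interval i) x)) \<in> borel_measurable G"
      by measurable
    ultimately show "e i \<in> borel_measurable G"
      unfolding e_def by (intro borel_measurable_times)
  qed
  have e: "(\<integral>x. e i x \<partial>G) = (if j < M i then 1 else 0)" for i
    unfolding e_def by (rule integral_zero_interval_psi)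
  have "(\<integral>x. of_real (block_martingale c k x) * cnj (\<psi> j x) \<partial>G) = of_real (block_coeff c j)" if "j < k" for k
  proof -
    have "(\<integral>x. of_real (block_martingale c k x) * cnj (\<psi> j x) \<partial>G)
      = (\<integral>x. (\<Sum>i<k. of_real (c i) * (e (Suc i) x - e i x)) \<partial>G)"
      by (simp add: block_martingale_def sum_distrib_right e_def left_diff_distrib mult.assoc)
    also have "\<dots> = (\<Sum>i<k. \<integral>x. of_real (c i) * (e (Suc i) x - e i x) \<partial>G)"
      by (rule Bochner_Integration.integral_sum)
        (intro integrable_mult_right Bochner_Integration.integrable_diff int)
    also have "\<dots> = (\<Sum>i<k. of_real (c i) * ((\<integral>x. e (Suc i) x \<partial>G) - (\<integral>x. e i x \<partial>G)))"
      using int by simp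
    also have "\<dots> = (\<Sum>i<k. if M i \<le> j \<and> j < M (Suc i) then of_real (c i) else 0)"
    proof (rule sum.cong[OF refl])
      fix i
      have "M i \<le> M (Suc i)" by (rule M_mono) simp
      then show "of_real (c i) * ((\<integral>x. e (Suc i) x \<partial>G) - (\<integral>x. e i x \<partial>G))
          = (if M i \<le> j \<and> j < M (Suc i) then of_real (c i) else 0 :: complex)"
        unfolding e by auto
    qed
    also have "\<dots> = (\<Sum>i\<le>j. if M i \<le> j \<and> j < M (Suc i) then of_real (c i) else 0)"
    proof (rule sum.mono_neutral_right)
      show "\<forall>i\<in>{..<k} - {..j}. (if M i \<le> j \<and> j < M (Suc i) then of_real (c i) else 0 :: complex) = 0"
      proof
        fix i assume "i \<in> {..<k} - {..j}"
        then have "j < M i" using M_less[of i] by simp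
        then show "(if M i \<le> j \<and> j < M (Suc i) then of_real (c i) else 0 :: complex) = 0" by simp
      qed
    qed (use that in auto)
    also have "\<dots> = of_real (block_coeff c j)"
      unfolding block_coeff_def of_real_sum by (intro sum.cong) auto
    finally show ?thesis .
  qed
  then have "(\<lambda>k. \<integral>x. of_real (block_martingale c k x) * cnj (\<psi> j x) \<partial>G) \<longlonglongrightarrow> of_real (block_coeff c j)"
    by (intro tendsto_eventually eventually_mono[OF eventually_gt_at_top[of j]])
  then show ?thesis unfolding vil_coeff_def by (rule limI)
qed

text \<open>Bounds all partial sums up to \<open>M N\<close> uniformly, in terms of coefficients
  before \<open>N\<close> only; this permits choosing \<open>N\<close> afterwards.\<close>

lemma sum_block_coeff_le:
  assumes "\<And>i. c i \<ge> 0"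
  shows "(\<Sum>j<M N. \<bar>block_coeff c j\<bar>) \<le> (\<Sum>i<N. c i * M (Suc i))"
proof (induction N)
  case 0
  \<comment> \<open>As \<open>M 0 = 1\<close>, only \<open>j = 0\<close> is left, which belongs to
    no block.\<close>
  then show ?case by (simp add: vil_M_simps block_coeff_def)
next
  case (Suc N)
  have le: "M N \<le> M (Suc N)" by (rule M_mono) simp
  then have split: "{..<M (Suc N)} = {..<M N} \<union> {M N..<M (Suc N)}" by auto
  have "(\<Sum>j<M (Suc N). \<bar>block_coeff c j\<bar>)
      = (\<Sum>j<M N. \<bar>block_coeff c j\<bar>) + (\<Sum>j\<in>{M N..<M (Suc N)}. \<bar>block_coeff c j\<bar>)"
    unfolding split by (rule sum.union_disjoint) auto
  also have "(\<Sum>j\<in>{M N..<M (Suc N)}. \<bar>block_coeff c j\<bar>) = (\<Sum>j\<in>{M N..<M (Suc N)}. c N)"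
    using assms by (intro sum.cong) (auto simp: block_coeff_eq)
  also have "\<dots> = (real (M (Suc N)) - real (M N)) * c N" using le by (simp add: of_nat_diff)
  also have "\<dots> \<le> c N * M (Suc N)" using assms[of N] by (simp add: algebra_simps)
  finally show ?case using Suc by simp
qed

text \<open>Partial sums up to \<open>M N\<close> are bounded by the sum over \<open>i < N\<close>;
  beyond, they add \<open>c N * r N x * dirichlet i x\<close>. Summing over \<open>k < n\<close>
  isolates \<open>dirichlet_sum q\<close>.\<close>

lemma fejer_mean_block_ge:
  fixes c :: "nat \<Rightarrow> real"
  assumes c: "\<And>i. c i \<ge> 0" and q: "q \<le> M N"
  defines "n \<equiv> M N + q"
  defines "\<sigma> \<equiv> fejer_mean m (\<lambda>n x. of_real (block_martingale c n x)) n"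
  shows "c N * cmod (dirichlet_sum q x) \<le> n * (cmod (\<sigma> x) + (\<Sum>i<N. c i * M (Suc i)))"
proof -
  define B where "B = (\<Sum>i<N. c i * M (Suc i))"
  define S where "S k = vil_partial_sum m (\<lambda>n x. of_real (block_martingale c n x)) k x" for k
  have S: "S k = (\<Sum>j<k. of_real (block_coeff c j) * \<psi> j x)" for k
    by (simp add: S_def vil_partial_sum_def vil_coeff_block)
  have S_le: "cmod (S k) \<le> B" if "k \<le> M N" for k
  proof -
    have "cmod (S k) \<le> (\<Sum>j<k. \<bar>block_coeff c j\<bar>)"
      unfolding S by (rule sum_norm_le) (simp add: norm_mult)
    also have "\<dots> \<le> (\<Sum>j<M N. \<bar>block_coeff c j\<bar>)"
      using that by (intro sum_mono2) auto
    finally show ?thesis using sum_block_coeff_le[of c N, OF c] by (simp add: B_def)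
  qed
  have S_add: "S (M N + i) = S (M N) + of_real (c N) * r N x * dirichlet i x" if "i \<le> M N" for i
  proof -
    \<comment> \<open>Ensures that the indices \<open>M N + j\<close> with \<open>j < M N\<close>
      stay in block \<open>N\<close>.\<close>
    have "2 * M N \<le> M (Suc N)" unfolding vil_M_simps by (rule mult_le_mono1[OF ge2])
    then have "of_real (block_coeff c (M N + j)) * \<psi> (M N + j) x = of_real (c N) * r N x * \<psi> j x"
      if "j < i" for j
      using that \<open>i \<le> M N\<close> psi_add[of 1 N j x] ge2[of N] block_coeff_eq[of N "M N + j" c] by simp
    then show ?thesis unfolding S sum_lessThan_add by (simp add: dirichlet_def sum_distrib_left)
  qed
  \<comment> \<open>The remainder consists of \<open>n\<close> partial sums of modulus at most
    \<open>B\<close>.\<close>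
  define R where "R = (\<Sum>k<M N. S k) + (\<Sum>i<q. S (M N))"
  have "n > 0" using M_pos[of N] by (simp add: n_def)
  then have "of_nat n * \<sigma> x = (\<Sum>k<n. S k)"
    by (simp add: \<sigma>_def fejer_mean_def S_def)
  also have "\<dots> = R + of_real (c N) * r N x * dirichlet_sum q x"
    unfolding n_def sum_lessThan_add
    using q by (simp add: S_add R_def dirichlet_sum_def sum.distrib sum_distrib_left)
  finally have "of_real (c N) * r N x * dirichlet_sum q x = of_nat n * \<sigma> x - R" by simp
  then have "c N * cmod (dirichlet_sum q x) = cmod (of_nat n * \<sigma> x - R)"
    using c[of N] by (metis (no_types, lifting) abs_of_nonneg mult.right_neutral norm_mult norm_of_real norm_r)
  also have "\<dots> \<le> n * cmod (\<sigma> x) + cmod R"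
    using norm_triangle_ineq4[of "of_nat n * \<sigma> x" R] by (simp add: norm_mult)
  also have "cmod R \<le> (\<Sum>k<M N. B) + (\<Sum>i<q. B)"
    unfolding R_def using S_le by (intro norm_triangle_mono sum_norm_le) auto
  finally show ?thesis by (simp add: n_def B_def algebra_simps)
qed

section \<open>Quasinorms for the exponent 1/2 and membership in the Hardy space\<close>

lemma Lp_norm_half:
  assumes "integrable G (\<lambda>x. sqrt (cmod (h x)))"
  shows "Lp_norm G (1/2) (\<lambda>x. ennreal (cmod (h x))) = ennreal ((root_integral h)\<^sup>2)"
proof -
  have "(\<integral>\<^sup>+ x. enn_powr (ennreal (cmod (h x))) (1/2) \<partial>G) = (\<integral>\<^sup>+ x. ennreal (sqrt (cmod (h x))) \<partial>G)"
    by (simp add: enn_powr_ennreal powr_half_sqrt)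
  also have "\<dots> = ennreal (root_integral h)"
    unfolding root_integral_def using assms by (intro nn_integral_eq_integral) auto
  finally have I: "(\<integral>\<^sup>+ x. enn_powr (ennreal (cmod (h x))) (1/2) \<partial>G) = ennreal (root_integral h)" .
  have "0 \<le> root_integral h" by (simp add: root_integral_def)
  then show ?thesis unfolding Lp_norm_def I by (simp add: enn_powr_ennreal powr_numeral)
qed

lemma integrable_sqrt_fejer_mean: "integrable G (\<lambda>x. sqrt (cmod (fejer_mean m f n x)))"
proof (rule integrable_sqrt_norm)
  show "fejer_mean m f n \<in> borel_measurable G"
    unfolding fejer_mean_def vil_partial_sum_def by measurable
  have "cmod (\<Sum>k<n. vil_partial_sum m f k x) \<le> (\<Sum>k<n. \<Sum>j<k. cmod (vil_coeff m f j))" for x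
    unfolding vil_partial_sum_def
    by (intro sum_norm_le) (auto simp: norm_mult)
  then show "cmod (fejer_mean m f n x) \<le> (\<Sum>k<n. \<Sum>j<k. cmod (vil_coeff m f j)) / n" for x
    by (simp add: fejer_mean_def norm_divide divide_right_mono)
qed

text \<open>Integrated square root of \<open>fejer_mean_block_ge\<close>, with
  \<open>K\<^sup>2\<close> as an upper bound for \<open>n / c N\<close> and the root split by
  subadditivity.\<close>

lemma root_integral_fejer_mean_block:
  fixes c :: "nat \<Rightarrow> real"
  assumes c: "\<And>i. c i \<ge> 0" and q: "q \<le> M N" and K: "K > 0" "M N + q \<le> c N * K\<^sup>2"
  shows "root_integral (dirichlet_sum q)
    \<le> K * (root_integral (fejer_mean m (\<lambda>n x. of_real (block_martingale c n x)) (M N + q))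
      + sqrt (\<Sum>i<N. c i * M (Suc i)))"
proof -
  define \<sigma> where "\<sigma> = fejer_mean m (\<lambda>n x. of_real (block_martingale c n x)) (M N + q)"
  define B where "B = (\<Sum>i<N. c i * M (Suc i))"
  have B: "B \<ge> 0" unfolding B_def using c by (intro sum_nonneg) auto
  have "0 < c N * K\<^sup>2" using K M_pos[of N] by linarith
  then have cN: "c N > 0" using c[of N] by (simp add: zero_less_mult_iff)
  have int: "integrable G (\<lambda>x. sqrt (cmod (\<sigma> x)))"
    unfolding \<sigma>_def by (rule integrable_sqrt_fejer_mean)
  have "sqrt (cmod (dirichlet_sum q x)) \<le> K * (sqrt (cmod (\<sigma> x)) + sqrt B)" for x
  proof -
    have "c N * cmod (dirichlet_sum q x) \<le> (M N + q) * (cmod (\<sigma> x) + B)"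
      unfolding \<sigma>_def B_def using c q by (rule fejer_mean_block_ge)
    also have "\<dots> \<le> (c N * K\<^sup>2) * (cmod (\<sigma> x) + B)"
      using K B by (intro mult_right_mono) auto
    finally have "cmod (dirichlet_sum q x) \<le> K\<^sup>2 * (cmod (\<sigma> x) + B)"
      using cN by (simp add: mult.assoc)
    then have "sqrt (cmod (dirichlet_sum q x)) \<le> sqrt (K\<^sup>2 * (cmod (\<sigma> x) + B))"
      by (rule real_sqrt_le_mono)
    also have "\<dots> = K * sqrt (cmod (\<sigma> x) + B)" using K by (simp add: real_sqrt_mult)
    also have "\<dots> \<le> K * (sqrt (cmod (\<sigma> x)) + sqrt B)"
      using K B by (intro mult_left_mono sqrt_add_le_add_sqrt) auto
    finally show ?thesis .
  qed
  then have "root_integral (dirichlet_sum q) \<le> (\<integral>x. K * (sqrt (cmod (\<sigma> x)) + sqrt B) \<partial>G)"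
    unfolding root_integral_def using int integrable_sqrt_dirichlet_sum by (intro integral_mono) auto
  also have "\<dots> = K * (root_integral \<sigma> + sqrt B)"
    using int by (simp add: root_integral_def prob_space)
  finally show ?thesis by (simp add: \<sigma>_def B_def)
qed

text \<open>The \<open>i\<close>-th increment is at most \<open>c i * M (Suc i)\<close> in modulus
  and lives on \<open>zero_interval i\<close>; the square root is subadditive.\<close>

lemma sqrt_block_martingale_le:
  fixes c :: "nat \<Rightarrow> real"
  assumes c: "\<And>i. c i \<ge> 0"
  shows "sqrt \<bar>block_martingale c n x\<bar> \<le> (\<Sum>i<n. sqrt (c i * M (Suc i)) * indicat_real (zero_interval i) x)"
proof (induction n)
  case 0
  then show ?case by (simp add: block_martingale_def)
next
  case (Suc n)
  define d where "d = M (Suc n) * indicat_real (zero_interval (Suc n)) x - M n * indicat_real (zero_interval n) x"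
  have le: "M n \<le> M (Suc n)" by (rule M_mono) simp
  have sub: "zero_interval (Suc n) \<subseteq> zero_interval n" by (rule zero_interval_antimono) simp
  have "\<bar>d\<bar> \<le> M (Suc n) * indicat_real (zero_interval n) x"
    using le sub unfolding d_def
    by (cases "x \<in> zero_interval n"; cases "x \<in> zero_interval (Suc n)") auto
  then have "\<bar>c n * d\<bar> \<le> c n * (M (Suc n) * indicat_real (zero_interval n) x)"
    using c[of n] by (simp add: abs_mult mult_left_mono)
  moreover have "block_martingale c (Suc n) x = block_martingale c n x + c n * d"
    by (simp add: block_martingale_def d_def)
  ultimately have "\<bar>block_martingale c (Suc n) x\<bar>
      \<le> \<bar>block_martingale c n x\<bar> + c n * M (Suc n) * indicat_real (zero_interval n) x"
    by (simp add: mult.assoc)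
  then have "sqrt \<bar>block_martingale c (Suc n) x\<bar>
      \<le> sqrt (\<bar>block_martingale c n x\<bar> + c n * M (Suc n) * indicat_real (zero_interval n) x)"
    by (rule real_sqrt_le_mono)
  also have "\<dots> \<le> sqrt \<bar>block_martingale c n x\<bar> + sqrt (c n * M (Suc n) * indicat_real (zero_interval n) x)"
    using c[of n] by (intro sqrt_add_le_add_sqrt) auto
  also have "sqrt (c n * M (Suc n) * indicat_real (zero_interval n) x)
      = sqrt (c n * M (Suc n)) * indicat_real (zero_interval n) x"
    by (simp add: indicator_def)
  finally show ?case using Suc by simp
qed

text \<open>The bound of \<open>sqrt_block_martingale_le\<close> increases with \<open>n\<close>, so
  its limit \<open>H\<close> dominates the root of the maximal function. As
  \<open>zero_interval i\<close> has measure \<open>1 / M i\<close>, the integral of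
  \<open>H\<close> is the assumed series.\<close>

lemma block_martingale_in_hardy_space:
  fixes c :: "nat \<Rightarrow> real"
  assumes c: "\<And>i. c i \<ge> 0" and sum: "summable (\<lambda>i. sqrt (c i * M (Suc i)) / M i)"
  shows "(\<lambda>n x. complex_of_real (block_martingale c n x)) \<in> hardy_space m (1/2)"
proof -
  define s where "s i = sqrt (c i * M (Suc i))" for i
  have s: "s i \<ge> 0" for i using c by (simp add: s_def)
  define H where "H x = (\<Sum>i. ennreal (s i) * indicator (zero_interval i) x)" for x
  have bound: "ennreal (sqrt \<bar>block_martingale c n x\<bar>) \<le> H x" for n x
  proof -
    have "ennreal (sqrt \<bar>block_martingale c n x\<bar>) \<le> ennreal (\<Sum>i<n. s i * indicat_real (zero_interval i) x)"
      using sqrt_block_martingale_le[of c n x, OF c] by (simp add: s_def ennreal_leI)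
    also have "\<dots> = (\<Sum>i<n. ennreal (s i * indicat_real (zero_interval i) x))"
      using s by (intro sum_ennreal[symmetric]) auto
    also have "\<dots> = (\<Sum>i<n. ennreal (s i) * indicator (zero_interval i) x)"
      by (intro sum.cong) (auto simp: indicator_def)
    also have "\<dots> \<le> H x" unfolding H_def by (rule sum_le_suminf) auto
    finally show ?thesis .
  qed
  let ?f = "\<lambda>n x. complex_of_real (block_martingale c n x)"
  have max: "enn_powr (max_fun ?f x) (1/2) \<le> H x" for x
  proof (cases "H x")
    case (real h)
    have "max_fun ?f x \<le> ennreal (h\<^sup>2)"
      unfolding max_fun_def
    proof (rule SUP_least)
      fix n
      have "sqrt \<bar>block_martingale c n x\<bar> \<le> h" using bound[of n x] real by simp
      then have "\<bar>block_martingale c n x\<bar> \<le> h\<^sup>2" by (simp add: sqrt_le_D)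
      then show "ennreal (cmod (complex_of_real (block_martingale c n x))) \<le> ennreal (h\<^sup>2)"
        by (simp add: ennreal_leI)
    qed
    then obtain t where t: "max_fun ?f x = ennreal t" "0 \<le> t" "t \<le> h\<^sup>2"
      by (cases "max_fun ?f x") (auto simp: top_unique)
    then have "sqrt t \<le> h" using real by (simp add: real_le_lsqrt)
    then show ?thesis using t real by (simp add: enn_powr_ennreal powr_half_sqrt ennreal_leI)
  qed simp
  have "(\<integral>\<^sup>+ x. enn_powr (max_fun ?f x) (1/2) \<partial>G) \<le> (\<integral>\<^sup>+ x. H x \<partial>G)"
    using max by (intro nn_integral_mono) auto
  also have "\<dots> = (\<Sum>i. \<integral>\<^sup>+ x. ennreal (s i) * indicator (zero_interval i) x \<partial>G)"
    unfolding H_def by (rule nn_integral_suminf) measurable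
  also have "\<dots> = (\<Sum>i. ennreal (s i / M i))"
    using s by (simp add: nn_integral_cmult_indicator emeasure_eq_measure measure_zero_interval
        ennreal_mult[symmetric])
  also have "\<dots> = ennreal (\<Sum>i. s i / M i)"
    using s sum by (intro suminf_ennreal2) (auto simp: s_def)
  finally have "(\<integral>\<^sup>+ x. enn_powr (max_fun ?f x) (1/2) \<partial>G) \<noteq> \<infinity>"
    by (auto simp: top_unique)
  then have "Lp_norm G (1/2) (max_fun ?f) < \<infinity>"
    by (simp add: Lp_norm_def enn_powr_def less_top[symmetric])
  then show ?thesis by (simp add: hardy_space_def vil_martingale_block)
qed

section \<open>Choice of the block positions and conclusion\<close>

lemma exists_block_positions:
  "\<exists>N. strict_mono N \<and> (\<forall>k. \<exists>q \<le> M (N (Suc k)).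
    2 ^ (k + 2) * (k + sqrt (\<Sum>i\<le>N k. M i * M (Suc i))) \<le> root_integral (dirichlet_sum q))"
proof -
  \<comment> \<open>The root dominates the earlier blocks, with \<open>M i\<close> in place of their
    coefficients, so that it can be stated before these are fixed.\<close>
  let ?Q = "\<lambda>k n n'. n < n' \<and> (\<exists>q \<le> M n'.
    2 ^ (k + 2) * (k + sqrt (\<Sum>i\<le>n. M i * M (Suc i))) \<le> root_integral (dirichlet_sum q))"
  have "\<exists>N. \<forall>k. True \<and> ?Q k (N k) (N (Suc k))"
  proof (rule dependent_nat_choice)
    fix n k :: nat
    \<comment> \<open>The left-hand side depends on \<open>k\<close> and \<open>n\<close> only.
      First \<open>q\<close> is found, then the next position large enough for
      \<open>q \<le> M n'\<close>.\<close>
    obtain q where "2 ^ (k + 2) * (k + sqrt (\<Sum>i\<le>n. M i * M (Suc i))) \<le> root_integral (dirichlet_sum q)"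
      using root_integral_dirichlet_sum_unbounded by blast
    moreover have "q \<le> M (max (Suc n) q)"
      using M_less[of q] M_mono[of q "max (Suc n) q"] by simp
    moreover have "n < max (Suc n) q" by simp
    ultimately show "\<exists>n'. True \<and> ?Q k n n'" by blast
  qed auto
  then show ?thesis by (metis strict_mono_Suc_iff)
qed

lemma ex_unbounded_fejer_means:
  assumes bdd: "bdd_above (range m)"
  shows "\<exists>f \<in> hardy_space m (1/2).
    (SUP n\<in>{1..}. Lp_norm G (1/2) (\<lambda>x. ennreal (cmod (fejer_mean m f n x)))) = \<infinity>"
proof -
  obtain N where N: "strict_mono N"
    and q: "\<And>k. \<exists>q \<le> M (N (Suc k)). 2 ^ (k + 2) * (k + sqrt (\<Sum>i\<le>N k. M i * M (Suc i)))
      \<le> root_integral (dirichlet_sum q)"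
    using exists_block_positions by blast
  have inj: "inj N" using N by (rule strict_mono_imp_inj_on)
  \<comment> \<open>Here \<open>inv N i\<close> is the number of the block at \<open>i\<close>. The
    root of \<open>4 ^ k\<close> makes the Hardy series geometric with ratio
    \<open>1/2\<close>.\<close>
  define c where "c i = (if i \<in> range N then M i / 4 ^ (inv N i) else 0 :: real)" for i
  have c_N: "c (N k) = M (N k) / 4 ^ k" for k by (simp add: c_def inv_f_f[OF inj])
  have c0: "c i \<ge> 0" for i by (simp add: c_def)
  have c_le: "c i \<le> M i" for i
  proof -
    have "(1::real) \<le> 4 ^ inv N i" by (rule one_le_power) simp
    then show ?thesis by (simp add: c_def divide_le_eq mult_le_cancel_left1)
  qed
  \<comment> \<open>Boundedness of the group enters here: the \<open>k\<close>-th term of the Hardy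
    series is \<open>sqrt (m (N k)) / 2 ^ k\<close>.\<close>
  obtain b where b: "\<And>k. m k \<le> b" using bdd by (auto simp: bdd_above_def)
  have "summable (\<lambda>k. sqrt (c (N k) * M (Suc (N k))) / M (N k))"
  proof (rule summable_comparison_test')
    show "summable (\<lambda>k. sqrt b * (1/2) ^ k)" by (intro summable_mult summable_geometric) simp
    fix k
    have "c (N k) * M (Suc (N k)) = m (N k) * (M (N k))\<^sup>2 / (2 ^ k)\<^sup>2"
      by (simp add: c_N vil_M_simps power2_eq_square power_mult_distrib[symmetric])
    then have "sqrt (c (N k) * M (Suc (N k))) / M (N k) = sqrt (m (N k)) / 2 ^ k"
      using M_pos[of "N k"] by (simp add: real_sqrt_mult real_sqrt_divide)
    also have "\<dots> \<le> sqrt b * (1/2) ^ k"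
      using b[of "N k"] by (simp add: power_divide divide_right_mono)
    finally show "norm (sqrt (c (N k) * M (Suc (N k))) / M (N k)) \<le> sqrt b * (1/2) ^ k"
      using c0 by simp
  qed
  then have "summable (\<lambda>i. sqrt (c i * M (Suc i)) / M i)"
    by (subst (asm) summable_mono_reindex[OF N]) (auto simp: c_def)
  then have hardy: "(\<lambda>n x. complex_of_real (block_martingale c n x)) \<in> hardy_space m (1/2)" (is "?f \<in> _")
    using c0 by (intro block_martingale_in_hardy_space)
  let ?S = "SUP n\<in>{1..}. Lp_norm G (1/2) (\<lambda>x. ennreal (cmod (fejer_mean m ?f n x)))"
  have large: "of_nat k \<le> ?S" for k
  proof -
    obtain q where q: "q \<le> M (N (Suc k))"
      "2 ^ (k + 2) * (k + sqrt (\<Sum>i\<le>N k. M i * M (Suc i))) \<le> root_integral (dirichlet_sum q)"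
      using q by blast
    let ?n = "M (N (Suc k)) + q"
    have n1: "?n \<in> {1..}" using M_pos[of "N (Suc k)"] by simp
    have "N k < N (Suc k)" using N by (simp add: strict_mono_Suc_iff)
    \<comment> \<open>The blocks before \<open>N (Suc k)\<close> thus end at \<open>N k\<close>, the
      range covered by the choice of \<open>q\<close>.\<close>
    have zero: "c i = 0" if "N k < i" "i < N (Suc k)" for i
    proof -
      have "i \<noteq> N l" for l
        using that strict_mono_less[OF N, of k l] strict_mono_less[OF N, of l "Suc k"] by auto
      then show ?thesis by (auto simp: c_def)
    qed
    have "(\<Sum>i<N (Suc k). c i * M (Suc i)) = (\<Sum>i\<le>N k. c i * M (Suc i))"
      using \<open>N k < N (Suc k)\<close> zero by (intro sum.mono_neutral_right) auto
    also have "\<dots> \<le> (\<Sum>i\<le>N k. M i * M (Suc i))"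
      unfolding of_nat_sum of_nat_mult using c_le by (intro sum_mono mult_right_mono) auto
    finally have B: "sqrt (\<Sum>i<N (Suc k). c i * M (Suc i)) \<le> sqrt (\<Sum>i\<le>N k. M i * M (Suc i))"
      by simp
    \<comment> \<open>With \<open>K = 2 ^ (k + 2)\<close> the product
      \<open>c (N (Suc k)) * K\<^sup>2\<close> equals \<open>4 * M (N (Suc k))\<close>, enough to
      cover \<open>?n\<close>.\<close>
    have "real ?n \<le> 2 * M (N (Suc k))" using q by simp
    also have "\<dots> \<le> 4 * M (N (Suc k))" by simp
    also have "\<dots> = c (N (Suc k)) * (2 ^ (k + 2))\<^sup>2"
      by (simp add: c_N power2_eq_square power_mult_distrib[symmetric])
    finally have "real ?n \<le> c (N (Suc k)) * (2 ^ (k + 2))\<^sup>2" .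
    then have "root_integral (dirichlet_sum q) \<le> 2 ^ (k + 2) * (root_integral (fejer_mean m ?f ?n)
        + sqrt (\<Sum>i<N (Suc k). c i * M (Suc i)))"
      using q c0 by (intro root_integral_fejer_mean_block) auto
    with q(2) have "(2::real) ^ (k + 2) * (k + sqrt (\<Sum>i\<le>N k. M i * M (Suc i)))
        \<le> 2 ^ (k + 2) * (root_integral (fejer_mean m ?f ?n) + sqrt (\<Sum>i<N (Suc k). c i * M (Suc i)))"
      by (rule order_trans)
    \<comment> \<open>After cancelling \<open>K\<close>, the root on the left absorbs the earlier
      blocks by \<open>B\<close>, and \<open>k\<close> remains.\<close>
    then have "k + sqrt (\<Sum>i\<le>N k. M i * M (Suc i))
        \<le> root_integral (fejer_mean m ?f ?n) + sqrt (\<Sum>i<N (Suc k). c i * M (Suc i))"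
      by (rule mult_left_le_imp_le) simp
    with B have "real k \<le> root_integral (fejer_mean m ?f ?n)" by linarith
    then have "(real k)\<^sup>2 \<le> (root_integral (fejer_mean m ?f ?n))\<^sup>2"
      by (intro power_mono) auto
    moreover have "real k \<le> (real k)\<^sup>2" by (cases k) (auto simp: power2_eq_square)
    ultimately have "ennreal k \<le> Lp_norm G (1/2) (\<lambda>x. ennreal (cmod (fejer_mean m ?f ?n x)))"
      unfolding Lp_norm_half[OF integrable_sqrt_fejer_mean] by (intro ennreal_leI) linarith
    also have "\<dots> \<le> ?S" using n1 by (rule SUP_upper)
    finally show ?thesis by (simp add: ennreal_of_nat_eq_real_of_nat)
  qed
  have "?S = \<infinity>"
  proof (rule ccontr)
    assume "?S \<noteq> \<infinity>"
    then have "?S < top" by (simp only: less_top infinity_ennreal_def)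
    then obtain k where "?S < of_nat k" using ennreal_Ex_less_of_nat by blast
    with leD[OF large[of k]] show False by blast
  qed
  with hardy show ?thesis by blast
qed

end

theorem theorem1:
  fixes m :: "nat \<Rightarrow> nat"
  assumes "\<And>k. m k \<ge> 2"
    and "bdd_above (range m)"
  shows "\<exists>f \<in> hardy_space m (1/2).
           (SUP n\<in>{1..}. Lp_norm (vilenkin m) (1/2) (\<lambda>x. ennreal (cmod (fejer_mean m f n x)))) = \<infinity>"
proof -
  interpret vilenkin_group m by unfold_locales (rule assms)
  show ?thesis using assms(2) by (rule ex_unbounded_fejer_means)
qed

end
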